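(* There is a smooth, bijective, $SL(2,\mathbb{C})$-equivariant correspondence between the set $\mathbb{C}^2\setminus\{(0,0)\}$ of nonzero spinors and the set $\mathrm{Hor}^S$ of spin-decorated horospheres in hyperbolic 3-space $\mathbb{H}^3$.
   Context: A spinor is an element $\kappa=(\xi,\eta)\in\mathbb{C}^2$, regarded as a column vector; $SL(2,\mathbb{C})$ acts on spinors by matrix multiplication. The orientation-preserving isometry group of $\mathbb{H}^3$ is $PSL(2,\mathbb{C})$; in the upper half space model $\mathbb{U}^3=\{(x,y,z): z>0\}$ with boundary $\mathbb{C}\cup\{\infty\}$ it acts on the boundary by Möbius transformations. $SL(2,\mathbb{C})$, being the universal cover of $PSL(2,\mathbb{C})$, acts on $\mathbb{H}^3$ via $PSL(2,\mathbb{C})$. Decorated horospheres. A horosphere $H$ is isometric to the Euclidean plane, the parabolic isometries fixing $H$ acting as translations. A decoration on $H$ is a tangent oriented line field on $H$ invariant under all these translations (a parallel oriented line field), equivalently a parallel unit tangent vector field $v$ on $H$. $\mathrm{Hor}^D$ denotes the set of decorated horospheres. Spin frames. A frame is a right-handed orthonormal frame at a point of $\mathbb{H}^3$; $\mathrm{Fr}\to\mathbb{H}^3$ is the principal $SO(3)$-bundle of frames, and $\mathrm{Fr}^S\to\mathbb{H}^3$ is its double (universal) cover, a principal $\mathrm{Spin}(3)$-bundle, whose points are called spin frames. $PSL(2,\mathbb{C})$ acts simply transitively on $\mathrm{Fr}$, and this lifts to a simply transitive action of $SL(2,\mathbb{C})$ on $\mathrm{Fr}^S$. Rotating a spin frame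 by an angle $\alpha$ about an axis means lifting to $\mathrm{Fr}^S$ the path of frames rotated by angles from $0$ to $\alpha$ (rotation by $2\pi$ interchanges the two lifts of a frame; rotation by $4\pi$ is the identity). Spin decorations. Let $N^{out}$ (resp. $N^{in}$) be the unit normal field along $H$ pointing towards (resp. away from) the centre (point at infinity) of $H$. For a decoration $v$ on $H$, the inward frame field is $(N^{in},v,N^{in}\times v)$ and the outward frame field is $(N^{out},v,N^{out}\times v)$. An inward (resp. outward) spin decoration is a continuous lift of an inward (resp. outward) frame field along $H$ to $\mathrm{Fr}^S$. The outward spin decoration associated to an inward spin decoration $W^{in}$ is obtained by rotating $W^{in}$ by angle $-\pi$ about $v$ at each point; the inward spin decoration associated to an outward spin decoration $W^{out}$ is obtained by rotating $W^{out}$ by angle $\pi$ about $v$ at each point. A spin decoration on $H$ is a pair $W=(W^{in},W^{out})$ of inward and outward spin decorations associated to each other. $\mathrm{Hor}^S$ is the set of horospheres with spin decorations $(H,W)$. It is the (connected) double cover of $\mathrm{Hor}^D$, and $SL(2,\mathbb{C})$ acts on it via its action on spin frames. Smooth structures. The space of horospheres is naturally $S^2\times\mathbb{R}$, $\mathrm{Hor}^D\cong UTS^2\times\mathbb{R}$ where $UTS^2$ is the unit tangent bundle of $S^2$, and $\mathrm{Hor}^S$ carries the smooth structure making it a double cover of $\mathrm{Hor}^D$; equivalently $\mathrm{Hor}^D\cong PSL(2,\mathbb{C})/(\pm P)$ and $\mathrm{Hor}^S\cong SL(2,\mathbb{C})/P$ where $P$ is the group of upper triangular matrices with both diagonal entries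 $1$. *)

theory Defs
  imports "HOL-Analysis.Analysis"
begin

section \<open>Hyperbolic 3-space and the action of $SL(2,\mathbb{C})$\<close>

definition SL2C :: "(complex^2^2) set" where
  "SL2C = {A. det A = 1}"

definition parabolic_subgroup_P :: "(complex^2^2) set" where
  "parabolic_subgroup_P = {A. A$1$1 = 1 \<and> A$2$1 = 0 \<and> A$2$2 = 1}"

text \<open>The upper half space model, with metric $(dx^2 + dy^2 + dz^2) / z^2$.  Tangent vectors at any
  point are identified with vectors of the ambient space.\<close>

definition U3 :: "(real^3) set" where
  "U3 = {p. p$3 > 0}"

definition hyp_inner :: "real^3 \<Rightarrow> real^3 \<Rightarrow> real^3 \<Rightarrow> real" where
  "hyp_inner p u v = (u \<bullet> v) / (p$3)^2"

text \<open>The cross product of the tangent space at \<open>p\<close>, with respect to the hyperbolic metric and the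
  standard orientation: vectors of hyperbolic length 1 have Euclidean length \<open>p$3\<close>.\<close>

definition hyp_cross :: "real^3 \<Rightarrow> real^3 \<Rightarrow> real^3 \<Rightarrow> real^3" where
  "hyp_cross p u v = (1 / p$3) *\<^sub>R cross3 u v"

text \<open>The isometry whose boundary extension is the Moebius transformation
  $z \mapsto (az+b)/(cz+d)$.  Writing the point $(x,y,t)$ as the quaternion $q = (x+yi) + tj$, it is
  $q \mapsto (aq+b)(cq+d)^{-1}$.\<close>

definition mobius :: "complex^2^2 \<Rightarrow> real^3 \<Rightarrow> real^3" where
  "mobius A p =
    (let a = A$1$1; b = A$1$2; c = A$2$1; d = A$2$2;
         z = Complex (p$1) (p$2); t = p$3;
         n = (cmod (c * z + d))^2 + (cmod c * t)^2;
         w = ((a * z + b) * cnj (c * z + d) + a * cnj c * complex_of_real (t^2)) / complex_of_real n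
     in vector [Re w, Im w, t / n])"

definition mobius_deriv :: "complex^2^2 \<Rightarrow> real^3 \<Rightarrow> real^3 \<Rightarrow> real^3" where
  "mobius_deriv A p = frechet_derivative (mobius A) (at p)"

definition parabolic :: "complex^2^2 \<Rightarrow> bool" where
  "parabolic A \<longleftrightarrow> A \<in> SL2C \<and> (trace A)^2 = 4 \<and> A \<noteq> mat 1 \<and> A \<noteq> - mat 1"


section \<open>Frames and spin frames\<close>

text \<open>A frame is given as its base point followed by its three vectors.\<close>

type_synonym frame = "(real^3) \<times> (real^3) \<times> (real^3) \<times> (real^3)"

definition frames :: "frame set" where
  "frames = {(p, e1, e2, e3). p \<in> U3 \<and>
     hyp_inner p e1 e1 = 1 \<and> hyp_inner p e2 e2 = 1 \<and> hyp_inner p e3 e3 = 1 \<and>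
     hyp_inner p e1 e2 = 0 \<and> hyp_inner p e2 e3 = 0 \<and> hyp_inner p e1 e3 = 0 \<and>
     cross3 e1 e2 \<bullet> e3 > 0}"

definition frame_act :: "complex^2^2 \<Rightarrow> frame \<Rightarrow> frame" where
  "frame_act A = (\<lambda>(p, e1, e2, e3).
     (mobius A p, mobius_deriv A p e1, mobius_deriv A p e2, mobius_deriv A p e3))"

text \<open>\<open>E\<close> is the space of spin frames, \<open>pr\<close> sends a spin frame to its underlying frame, and \<open>act\<close>
  is the lift to \<open>E\<close> of the action on frames.  These data are determined up to isomorphism (a model
  is $SL(2,\mathbb{C})$ acting on itself by left multiplication, with projection
  $A \mapsto$ \<open>frame_act A f\<close> for a fixed frame \<open>f\<close>).\<close>

definition spin_frame_bundle ::
    "'e::topological_space set \<Rightarrow> ('e \<Rightarrow> frame) \<Rightarrow> (complex^2^2 \<Rightarrow> 'e \<Rightarrow> 'e) \<Rightarrow> bool" where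
  "spin_frame_bundle E pr act \<longleftrightarrow>
     covering_space E pr frames \<and> simply_connected E \<and>
     (\<forall>f\<in>frames. card {e\<in>E. pr e = f} = 2) \<and>
     (\<forall>A\<in>SL2C. \<forall>e\<in>E. act A e \<in> E \<and> pr (act A e) = frame_act A (pr e)) \<and>
     (\<forall>e\<in>E. act (mat 1) e = e) \<and>
     (\<forall>A\<in>SL2C. \<forall>B\<in>SL2C. \<forall>e\<in>E. act (A ** B) e = act A (act B e)) \<and>
     continuous_on (SL2C \<times> E) (\<lambda>(A, e). act A e) \<and>
     (\<forall>e\<in>E. \<forall>e'\<in>E. \<exists>!A. A \<in> SL2C \<and> act A e = e')"

text \<open>Rotation by \<open>\<theta>\<close> in the tangent space at \<open>p\<close> about the unit vector \<open>u\<close> (Rodrigues).\<close>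

definition rotate_vec :: "real^3 \<Rightarrow> real^3 \<Rightarrow> real \<Rightarrow> real^3 \<Rightarrow> real^3" where
  "rotate_vec p u \<theta> x =
     cos \<theta> *\<^sub>R x + sin \<theta> *\<^sub>R hyp_cross p u x + ((1 - cos \<theta>) * hyp_inner p u x) *\<^sub>R u"

definition rotate_frame :: "real^3 \<Rightarrow> real \<Rightarrow> frame \<Rightarrow> frame" where
  "rotate_frame u \<theta> = (\<lambda>(p, e1, e2, e3).
     (p, rotate_vec p u \<theta> e1, rotate_vec p u \<theta> e2, rotate_vec p u \<theta> e3))"

text \<open>\<open>e'\<close> is obtained from the spin frame \<open>e\<close> by rotation by \<open>\<theta>\<close> about \<open>u\<close>.\<close>

definition spin_rotation ::
    "'e::topological_space set \<Rightarrow> ('e \<Rightarrow> frame) \<Rightarrow> real^3 \<Rightarrow> real \<Rightarrow> 'e \<Rightarrow> 'e \<Rightarrow> bool" where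
  "spin_rotation E pr u \<theta> e e' \<longleftrightarrow>
     (\<exists>\<gamma>. path \<gamma> \<and> path_image \<gamma> \<subseteq> E \<and> pathstart \<gamma> = e \<and> pathfinish \<gamma> = e' \<and>
          (\<forall>s\<in>{0..1}. pr (\<gamma> s) = rotate_frame u (s * \<theta>) (pr e)))"


section \<open>Horospheres and their decorations\<close>

datatype ideal_point = Finite_Point complex | Infinite_Point

text \<open>A horosphere centred at infinity is a horizontal plane, \<open>r\<close> being its height; a horosphere
  centred at \<open>w\<close> is a Euclidean sphere tangent to the boundary at \<open>w\<close> (with the point of tangency
  removed), \<open>r\<close> being its Euclidean radius.\<close>

fun horosphere :: "ideal_point \<Rightarrow> real \<Rightarrow> (real^3) set" where
  "horosphere Infinite_Point r = {p. p$3 = r}"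
| "horosphere (Finite_Point w) r = U3 \<inter> sphere (vector [Re w, Im w, r]) r"

text \<open>The unit normal pointing towards the centre.  For a finite centre this is the normal pointing
  into the Euclidean ball: the geodesics perpendicular to the horosphere tend to the centre
  inside the horoball.\<close>

fun N_out :: "ideal_point \<Rightarrow> real \<Rightarrow> real^3 \<Rightarrow> real^3" where
  "N_out Infinite_Point r p = vector [0, 0, p$3]"
| "N_out (Finite_Point w) r p = (p$3 / r) *\<^sub>R (vector [Re w, Im w, r] - p)"

definition N_in :: "ideal_point \<Rightarrow> real \<Rightarrow> real^3 \<Rightarrow> real^3" where
  "N_in \<xi> r p = - N_out \<xi> r p"

text \<open>Fields along a horosphere are extensional functions, so that they are determined by their
  values on the horosphere.\<close>

definition decoration :: "ideal_point \<Rightarrow> real \<Rightarrow> (real^3 \<Rightarrow> real^3) \<Rightarrow> bool" where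
  "decoration \<xi> r v \<longleftrightarrow>
     v \<in> extensional (horosphere \<xi> r) \<and>
     (\<forall>p\<in>horosphere \<xi> r. hyp_inner p (v p) (v p) = 1 \<and> hyp_inner p (v p) (N_out \<xi> r p) = 0) \<and>
     (\<forall>A. parabolic A \<and> mobius A ` horosphere \<xi> r = horosphere \<xi> r \<longrightarrow>
        (\<forall>p\<in>horosphere \<xi> r. mobius_deriv A p (v p) = v (mobius A p)))"

definition inward_frame :: "ideal_point \<Rightarrow> real \<Rightarrow> (real^3 \<Rightarrow> real^3) \<Rightarrow> real^3 \<Rightarrow> frame" where
  "inward_frame \<xi> r v p = (p, N_in \<xi> r p, v p, hyp_cross p (N_in \<xi> r p) (v p))"

definition outward_frame :: "ideal_point \<Rightarrow> real \<Rightarrow> (real^3 \<Rightarrow> real^3) \<Rightarrow> real^3 \<Rightarrow> frame" where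
  "outward_frame \<xi> r v p = (p, N_out \<xi> r p, v p, hyp_cross p (N_out \<xi> r p) (v p))"

definition continuous_lift ::
    "'e::topological_space set \<Rightarrow> ('e \<Rightarrow> frame) \<Rightarrow> (real^3) set \<Rightarrow> (real^3 \<Rightarrow> frame)
      \<Rightarrow> (real^3 \<Rightarrow> 'e) \<Rightarrow> bool" where
  "continuous_lift E pr H F W \<longleftrightarrow>
     W \<in> extensional H \<and> continuous_on H W \<and> (\<forall>p\<in>H. W p \<in> E \<and> pr (W p) = F p)"

definition associated_spin_decorations ::
    "'e::topological_space set \<Rightarrow> ('e \<Rightarrow> frame) \<Rightarrow> (real^3) set \<Rightarrow> (real^3 \<Rightarrow> real^3)
      \<Rightarrow> (real^3 \<Rightarrow> 'e) \<Rightarrow> (real^3 \<Rightarrow> 'e) \<Rightarrow> bool" where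
  "associated_spin_decorations E pr H v Win Wout \<longleftrightarrow>
     (\<forall>p\<in>H. spin_rotation E pr (v p) (- pi) (Win p) (Wout p) \<and>
            spin_rotation E pr (v p) pi (Wout p) (Win p))"

text \<open>A spin-decorated horosphere is the horosphere together with its inward and outward spin
  decorations.\<close>

type_synonym 'e spin_horosphere = "(real^3) set \<times> (real^3 \<Rightarrow> 'e) \<times> (real^3 \<Rightarrow> 'e)"

definition HorS ::
    "'e::topological_space set \<Rightarrow> ('e \<Rightarrow> frame) \<Rightarrow> 'e spin_horosphere set" where
  "HorS E pr = {(H, Win, Wout). \<exists>\<xi> r v. r > 0 \<and> H = horosphere \<xi> r \<and> decoration \<xi> r v \<and>
     continuous_lift E pr H (inward_frame \<xi> r v) Win \<and>
     continuous_lift E pr H (outward_frame \<xi> r v) Wout \<and>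
     associated_spin_decorations E pr H v Win Wout}"

definition transport_field ::
    "(complex^2^2 \<Rightarrow> 'e \<Rightarrow> 'e) \<Rightarrow> complex^2^2 \<Rightarrow> (real^3) set \<Rightarrow> (real^3 \<Rightarrow> 'e) \<Rightarrow> (real^3 \<Rightarrow> 'e)" where
  "transport_field act A H W =
     restrict (\<lambda>q. act A (W (mobius (matrix_inv A) q))) (mobius A ` H)"

definition HorS_act ::
    "(complex^2^2 \<Rightarrow> 'e \<Rightarrow> 'e) \<Rightarrow> complex^2^2 \<Rightarrow> 'e spin_horosphere \<Rightarrow> 'e spin_horosphere" where
  "HorS_act act A = (\<lambda>(H, Win, Wout).
     (mobius A ` H, transport_field act A H Win, transport_field act A H Wout))"


section \<open>Smoothness\<close>

fun Ck_on :: "nat \<Rightarrow> 'a::real_normed_vector set \<Rightarrow> ('a \<Rightarrow> 'b::real_normed_vector) \<Rightarrow> bool" where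
  "Ck_on 0 S f \<longleftrightarrow> continuous_on S f"
| "Ck_on (Suc k) S f \<longleftrightarrow>
     (\<forall>x\<in>S. f differentiable at x) \<and> (\<forall>v. Ck_on k S (\<lambda>x. frechet_derivative f (at x) v))"

text \<open>Real $C^\infty$ smoothness on an open subset of a finite-dimensional space.\<close>

definition smooth_on :: "'a::euclidean_space set \<Rightarrow> ('a \<Rightarrow> 'b::euclidean_space) \<Rightarrow> bool" where
  "smooth_on S f \<longleftrightarrow> open S \<and> (\<forall>k. Ck_on k S f)"

text \<open>Smoothness on an arbitrary subset, used for relatively open subsets of the submanifold
  $SL(2,\mathbb{C})$ of the space of matrices.\<close>

definition locally_extends_smoothly ::
    "'a::euclidean_space set \<Rightarrow> ('a \<Rightarrow> 'b::euclidean_space) \<Rightarrow> bool" where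
  "locally_extends_smoothly S f \<longleftrightarrow>
     (\<forall>x\<in>S. \<exists>T g. x \<in> T \<and> smooth_on T g \<and> (\<forall>y\<in>S \<inter> T. g y = f y))"

text \<open>Let \<open>q\<close> be an orbit map of an action of $SL(2,\mathbb{C})$.  The following are the charts of the
  smooth structure for which \<open>q\<close> is a smooth submersion, that is, of the quotient of
  $SL(2,\mathbb{C})$ by the stabiliser: \<open>\<phi>\<close> is a bijection from an open set onto an open subset of a
  Euclidean space, it is smooth (after composition with \<open>q\<close>), and its inverse is smooth
  (locally it lifts through \<open>q\<close> to a smooth map).\<close>

definition quotient_chart ::
    "(complex^2^2 \<Rightarrow> 'h) \<Rightarrow> 'h set \<Rightarrow> ('h \<Rightarrow> 'b::euclidean_space) \<Rightarrow> bool" where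
  "quotient_chart q U \<phi> \<longleftrightarrow>
     openin (top_of_set SL2C) {A\<in>SL2C. q A \<in> U} \<and>
     inj_on \<phi> U \<and> open (\<phi> ` U) \<and>
     locally_extends_smoothly {A\<in>SL2C. q A \<in> U} (\<lambda>A. \<phi> (q A)) \<and>
     (\<forall>y\<in>\<phi> ` U. \<exists>Y \<sigma>. y \<in> Y \<and> Y \<subseteq> \<phi> ` U \<and> smooth_on Y \<sigma> \<and>
        (\<forall>x\<in>Y. \<sigma> x \<in> SL2C \<and> q (\<sigma> x) \<in> U \<and> \<phi> (q (\<sigma> x)) = x))"

text \<open>Charts of the 4-manifold \<open>HorS E pr\<close>, identified with $SL(2,\mathbb{C})/P$ by means of an orbit
  map.  Changing the base point \<open>h0\<close> amounts to a right translation of $SL(2,\mathbb{C})$, so the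
  smooth structure does not depend on it.\<close>

definition HorS_chart ::
    "'e::topological_space set \<Rightarrow> ('e \<Rightarrow> frame) \<Rightarrow> (complex^2^2 \<Rightarrow> 'e \<Rightarrow> 'e)
      \<Rightarrow> 'e spin_horosphere set \<Rightarrow> ('e spin_horosphere \<Rightarrow> real^4) \<Rightarrow> bool" where
  "HorS_chart E pr act U \<phi> \<longleftrightarrow>
     U \<subseteq> HorS E pr \<and>
     (\<exists>h0\<in>HorS E pr. {A\<in>SL2C. HorS_act act A h0 = h0} = parabolic_subgroup_P \<and>
        quotient_chart (\<lambda>A. HorS_act act A h0) U \<phi>)"

definition smooth_into_HorS ::
    "'e::topological_space set \<Rightarrow> ('e \<Rightarrow> frame) \<Rightarrow> (complex^2^2 \<Rightarrow> 'e \<Rightarrow> 'e)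
      \<Rightarrow> 'a::euclidean_space set \<Rightarrow> ('a \<Rightarrow> 'e spin_horosphere) \<Rightarrow> bool" where
  "smooth_into_HorS E pr act S f \<longleftrightarrow>
     (\<forall>x\<in>S. \<exists>X U \<phi>. x \<in> X \<and> X \<subseteq> S \<and> HorS_chart E pr act U \<phi> \<and> f ` X \<subseteq> U \<and>
        smooth_on X (\<lambda>x. \<phi> (f x)))"

definition smooth_from_HorS ::
    "'e::topological_space set \<Rightarrow> ('e \<Rightarrow> frame) \<Rightarrow> (complex^2^2 \<Rightarrow> 'e \<Rightarrow> 'e)
      \<Rightarrow> ('e spin_horosphere \<Rightarrow> 'a::euclidean_space) \<Rightarrow> bool" where
  "smooth_from_HorS E pr act g \<longleftrightarrow>
     (\<forall>h\<in>HorS E pr. \<exists>U \<phi>. h \<in> U \<and> HorS_chart E pr act U \<phi> \<and>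
        smooth_on (\<phi> ` U) (\<lambda>y. g (inv_into U \<phi> y)))"


section \<open>Spinors\<close>

definition nonzero_spinors :: "(complex^2) set" where
  "nonzero_spinors = {\<kappa>. \<kappa> \<noteq> 0}"

end

theory Submission
  imports Defs
begin

text \<open>Write $e_1 = (1,0)$. The group $SL(2,\mathbb{C})$ acts transitively on the nonzero spinors, and
the stabiliser of $e_1$ is the group $P$ of upper triangular matrices with diagonal entries 1,
which act on the upper half space as horizontal translations. An equivariant bijection onto the
spin-decorated horospheres therefore amounts to a spin-decorated horosphere \<open>h\<close>
whose stabiliser is exactly $P$ and whose orbit is everything; the correspondence is then $A e_1
\mapsto A h$.

The element \<open>h\<close> (\<open>base_element\<close>) lies on the plane at height 1. Its
decoration is the constant field in the direction of the first axis, and its spin decorations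
are obtained by translating one spin frame over $(0,0,1)$ along the plane. The inward and
outward spin decorations are joined by a one-parameter group of rotations in $SL(2,\mathbb{C})$,
acting on that spin frame. Two facts about \<open>h\<close> rest on the simply transitive action
on spin frames. The stabiliser is $P$: translations fix \<open>h\<close> by construction, and an
element of the stabiliser maps some inward spin frame of \<open>h\<close> to the one over
$(0,0,1)$, as a translation does, hence is a translation
(\<open>stabiliser_base_element\<close>). The action is transitive: some group element takes the
spin frame of \<open>h\<close> over $(0,0,1)$ to a given inward spin frame of a given
spin-decorated horosphere, and a single inward spin frame determines everything else
(\<open>base_element_unique\<close>). It determines the horosphere, by its normal; the
decoration, by translation invariance; the inward spin decoration, by uniqueness of lifts; and
the outward one, by uniqueness of the lifted rotation.

That the group acts on spin-decorated horospheres at all (\<open>HorS_act_closed\<close>) needs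
the isometric nature of the Moebius action, the fact that it permutes horospheres, and the
equivariance of their normals. The first is read off from the bundle: group elements lift to
maps of spin frames, so they send orthonormal right-handed frames to such frames. The other two
follow from one invariant function. For a spinor $\kappa = (a,c)$ and a point $(z,t)$ put
$h_\kappa(z,t) = (|a - cz|^2 + |c|^2t^2)/t$; this is the reciprocal of the height of
$B^{-1}(z,t)$ for any $B \in SL(2,\mathbb{C})$ with $B e_1 = \kappa$. Hence $h_{A\kappa}(Ap) =
h_\kappa(p)$, the level set $h_\kappa = 1$ is a horosphere, every horosphere is of this form,
and the hyperbolic gradient of $h_\kappa$ along it is the unit normal pointing away from the
centre.

For smoothness, the columns $\kappa$ and $(-\bar c, \bar a)/|\kappa|^2$ form a matrix in
$SL(2,\mathbb{C})$ that depends smoothly on $\kappa \neq 0$ and has first column $\kappa$. With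
this global section the inverse of the correspondence, read in $\mathbb{C}^2 = \mathbb{R}^4$, is
a single chart covering all spin-decorated horospheres, and in this chart the correspondence and
its inverse are linear.\<close>

section \<open>Differentiability classes\<close>

text \<open>The derivatives at a point of an open set see only the values on that set.\<close>

lemma Ck_on_cong:
  assumes "open S" and "Ck_on k S g" and "\<And>x. x \<in> S \<Longrightarrow> f x = g x"
  shows "Ck_on k S f"
  using assms(2,3)
proof (induction k arbitrary: f g)
  case 0
  then show ?case by (simp cong: continuous_on_cong)
next
  case (Suc k)
  have deriv: "(f has_derivative frechet_derivative g (at x)) (at x)" if "x \<in> S" for x
  proof (rule has_derivative_transform_within_open)
    show "(g has_derivative frechet_derivative g (at x)) (at x)"
      using Suc.prems(1) that by (simp add: frechet_derivative_works)
  qed (use \<open>open S\<close> that Suc.prems(2) in auto)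
  then have "frechet_derivative f (at x) = frechet_derivative g (at x)" if "x \<in> S" for x
    using frechet_derivative_at[OF deriv[OF that]] by simp
  then have "Ck_on k S (\<lambda>x. frechet_derivative f (at x) v)" for v
    using Suc.prems(1) by (auto intro: Suc.IH[of "\<lambda>x. frechet_derivative g (at x) v"])
  with deriv show ?case
    by (auto simp: differentiable_def)
qed

text \<open>This reduces a smoothness proof to exhibiting the derivative, with no reference to
\<open>frechet_derivative\<close>.\<close>

lemma Ck_on_SucI:
  assumes "open S" and deriv: "\<And>x. x \<in> S \<Longrightarrow> (f has_derivative f' x) (at x)"
    and "\<And>v. Ck_on k S (\<lambda>x. f' x v)"
  shows "Ck_on (Suc k) S f"
proof -
  have "frechet_derivative f (at x) = f' x" if "x \<in> S" for x
    using frechet_derivative_at[OF deriv[OF that]] by simp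
  then have "Ck_on k S (\<lambda>x. frechet_derivative f (at x) v)" for v
    by (intro Ck_on_cong[OF assms(1) assms(3)[of v]]) auto
  with deriv show ?thesis
    by (auto simp: differentiable_def)
qed

lemma Ck_on_SucD:
  assumes "Ck_on (Suc k) S f"
  shows "x \<in> S \<Longrightarrow> (f has_derivative frechet_derivative f (at x)) (at x)"
    and "Ck_on k S (\<lambda>x. frechet_derivative f (at x) v)"
  using assms by (auto simp: frechet_derivative_works)

lemma Ck_on_mono: "Ck_on (Suc k) S f \<Longrightarrow> Ck_on k S f"
proof (induction k arbitrary: f)
  case 0
  then show ?case
    by (auto intro!: continuous_at_imp_continuous_on differentiable_imp_continuous_within)
next
  case (Suc k)
  then show ?case by (metis Ck_on.simps(2))
qed

lemma Ck_on_const: "open S \<Longrightarrow> Ck_on k S (\<lambda>x. c)"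
proof (induction k arbitrary: c)
  case (Suc k)
  then show ?case by (intro Ck_on_SucI[where f' = "\<lambda>x v. 0"]) auto
qed simp

lemma Ck_on_bounded_linear:
  assumes "open S" and f: "bounded_linear f"
  shows "Ck_on k S f"
proof (cases k)
  case 0
  then show ?thesis by (simp add: linear_continuous_on f)
next
  case (Suc n)
  have "Ck_on (Suc n) S f"
    by (rule Ck_on_SucI[where f' = "\<lambda>x. f"])
      (use assms in \<open>auto intro: bounded_linear_imp_has_derivative Ck_on_const\<close>)
  then show ?thesis by (simp only: Suc)
qed

lemma Ck_on_add:
  "open S \<Longrightarrow> Ck_on k S f \<Longrightarrow> Ck_on k S g \<Longrightarrow> Ck_on k S (\<lambda>x. f x + g x)"
proof (induction k arbitrary: f g)
  case (Suc k)
  show ?case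
    by (rule Ck_on_SucI[where f' = "\<lambda>x v. frechet_derivative f (at x) v + frechet_derivative g (at x) v"])
      (use Suc in \<open>auto intro!: has_derivative_add Ck_on_SucD\<close>)
qed (simp add: continuous_on_add)

text \<open>By the product rule the derivative is a sum of two terms of the same bilinear shape.\<close>

lemma Ck_on_bilinear:
  assumes B: "bounded_bilinear B" and S: "open S"
  shows "Ck_on k S f \<Longrightarrow> Ck_on k S g \<Longrightarrow> Ck_on k S (\<lambda>x. B (f x) (g x))"
proof (induction k arbitrary: f g)
  case 0
  then show ?case by (simp add: bounded_bilinear.continuous_on[OF B])
next
  case (Suc k)
  show ?case
  proof (rule Ck_on_SucI[OF S])
    show "((\<lambda>x. B (f x) (g x)) has_derivative
      (\<lambda>v. B (f x) (frechet_derivative g (at x) v) + B (frechet_derivative f (at x) v) (g x))) (at x)"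
      if "x \<in> S" for x
      by (rule bounded_bilinear.FDERIV[OF B Ck_on_SucD(1)[OF Suc.prems(1) that]
            Ck_on_SucD(1)[OF Suc.prems(2) that]])
    show "Ck_on k S (\<lambda>x. B (f x) (frechet_derivative g (at x) v)
        + B (frechet_derivative f (at x) v) (g x))" for v
      by (intro Ck_on_add S Suc.IH Ck_on_mono[OF Suc.prems(1)] Ck_on_mono[OF Suc.prems(2)]
          Ck_on_SucD(2)[OF Suc.prems(1)] Ck_on_SucD(2)[OF Suc.prems(2)])
  qed
qed

text \<open>The derivative of $1/g$ is $-(1/g) g' (1/g)$, and in the inductive step $1/g$ and $g'$ are
already known to be one order less smooth.\<close>

lemma Ck_on_inverse:
  fixes g :: "'a::real_normed_vector \<Rightarrow> real"
  assumes S: "open S" and nz: "\<And>x. x \<in> S \<Longrightarrow> g x \<noteq> 0"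
  shows "Ck_on k S g \<Longrightarrow> Ck_on k S (\<lambda>x. inverse (g x))"
proof (induction k)
  case 0
  then show ?case using nz by (simp add: continuous_on_inverse)
next
  case (Suc k)
  have inv: "Ck_on k S (\<lambda>x. inverse (g x))"
    by (rule Suc.IH[OF Ck_on_mono[OF Suc.prems]])
  show ?case
  proof (rule Ck_on_SucI[OF S])
    show "((\<lambda>x. inverse (g x)) has_derivative
        (\<lambda>v. - 1 * (inverse (g x) * frechet_derivative g (at x) v * inverse (g x)))) (at x)"
      if "x \<in> S" for x
      using Deriv.has_derivative_inverse[OF nz[OF that] Ck_on_SucD(1)[OF Suc.prems that]] by simp
    show "Ck_on k S (\<lambda>x. - 1 * (inverse (g x) * frechet_derivative g (at x) v * inverse (g x)))" for v
      by (intro Ck_on_bilinear[OF bounded_bilinear_mult S] Ck_on_const S inv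
          Ck_on_SucD(2)[OF Suc.prems, of v])
  qed
qed

lemma smooth_on_bounded_linear: "open S \<Longrightarrow> bounded_linear f \<Longrightarrow> smooth_on S f"
  by (simp add: smooth_on_def Ck_on_bounded_linear)

lemma smooth_on_cong: "smooth_on S g \<Longrightarrow> (\<And>x. x \<in> S \<Longrightarrow> f x = g x) \<Longrightarrow> smooth_on S f"
  unfolding smooth_on_def using Ck_on_cong by blast

lemma locally_extends_smoothly_bounded_linear:
  assumes "bounded_linear g" "\<And>x. x \<in> S \<Longrightarrow> f x = g x"
  shows "locally_extends_smoothly S f"
  unfolding locally_extends_smoothly_def
  using assms smooth_on_bounded_linear[OF open_UNIV assms(1)] by (metis UNIV_I IntD1)

text \<open>The nonzero spinors and the image of the chart built on them are both of this form.\<close>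

lemma open_nonzero: "open {x::'a::euclidean_space. x \<noteq> 0}"
  by (simp add: Collect_neg_eq[symmetric] open_Collect_neq)

section \<open>Uniqueness of lifts\<close>

text \<open>The total space of the spin frame bundle is only known as a topological space, so uniqueness is
needed for coverings without a norm on the total space. Whether the two lifts agree is a locally
constant property, and the domain is connected.\<close>

lemma covering_lift_unique:
  fixes pr :: "'e::topological_space \<Rightarrow> 'b::topological_space"
    and g1 g2 :: "'a::topological_space \<Rightarrow> 'e"
  assumes cov: "covering_space E pr S" and T: "connected T"
    and g1: "continuous_on T g1" "\<And>x. x \<in> T \<Longrightarrow> g1 x \<in> E"
    and g2: "continuous_on T g2" "\<And>x. x \<in> T \<Longrightarrow> g2 x \<in> E"
    and eq: "\<And>x. x \<in> T \<Longrightarrow> pr (g1 x) = pr (g2 x)"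
    and a: "a \<in> T" "g1 a = g2 a" and x: "x \<in> T"
  shows "g1 x = g2 x"
proof -
  have "\<exists>U. openin (top_of_set T) U \<and> y \<in> U \<and>
      (\<forall>z\<in>U. (g1 z = g2 z) = (g1 y = g2 y))" if y: "y \<in> T" for y
  proof -
    have "pr (g1 y) \<in> S"
      and sheets: "\<forall>x\<in>S. \<exists>V. x \<in> V \<and> openin (top_of_set S) V \<and>
        (\<exists>vs. \<Union>vs = E \<inter> pr -` V \<and> (\<forall>u\<in>vs. openin (top_of_set E) u) \<and>
          pairwise disjnt vs \<and> (\<forall>u\<in>vs. \<exists>q. homeomorphism u V pr q))"
      using cov g1(2)[OF y] unfolding covering_space_def by auto
    then obtain V vs where V: "pr (g1 y) \<in> V" "\<Union>vs = E \<inter> pr -` V"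
      "\<forall>u\<in>vs. openin (top_of_set E) u" "pairwise disjnt vs"
      "\<forall>u\<in>vs. \<exists>q. homeomorphism u V pr q"
      using bspec[OF sheets \<open>pr (g1 y) \<in> S\<close>] by auto
    have inj: "inj_on pr u" if "u \<in> vs" for u
      using V(5) that by (metis homeomorphism_apply1 inj_on_inverseI)
    have "g1 y \<in> \<Union>vs" "g2 y \<in> \<Union>vs"
      unfolding V(2) using V(1) y g1(2) g2(2) eq by auto
    then obtain u1 u2 where u: "u1 \<in> vs" "g1 y \<in> u1" "u2 \<in> vs" "g2 y \<in> u2" by auto
    \<comment> \<open>Near \<open>y\<close> the two lifts stay in their sheets: equal sheets force agreement because \<open>pr\<close> is
      injective on a sheet, different sheets are disjoint.\<close>
    define U where "U = (T \<inter> g1 -` u1) \<inter> (T \<inter> g2 -` u2)"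
    have "openin (top_of_set T) U"
      unfolding U_def using g1 g2 V(3) u
      by (intro openin_Int continuous_openin_preimage[where T = E]) auto
    moreover have "y \<in> U" using u y by (auto simp: U_def)
    moreover have "(g1 z = g2 z) = (g1 y = g2 y)" if "z \<in> U" for z
    proof (cases "u1 = u2")
      case True
      then show ?thesis
        using that u y inj[OF u(1)] eq by (auto simp: U_def inj_on_def)
    next
      case False
      then have "u1 \<inter> u2 = {}" using V(4) u by (auto simp: pairwise_def disjnt_def)
      then show ?thesis using that u by (auto simp: U_def)
    qed
    ultimately show ?thesis by blast
  qed
  then have "(\<lambda>z. g1 z = g2 z) constant_on T"
    by (rule locally_constant_imp_constant[OF T])
  then show ?thesis
    using a x unfolding constant_on_def by metis
qed

section \<open>The group SL(2,C)\<close>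

definition mat2 :: "complex \<Rightarrow> complex \<Rightarrow> complex \<Rightarrow> complex \<Rightarrow> complex^2^2" where
  "mat2 a b c d = vector [vector [a, b], vector [c, d]]"

lemma mat2_nth [simp]:
  "mat2 a b c d $ 1 $ 1 = a" "mat2 a b c d $ 1 $ 2 = b"
  "mat2 a b c d $ 2 $ 1 = c" "mat2 a b c d $ 2 $ 2 = d"
  by (simp_all add: mat2_def)

lemma mat2_eq_iff:
  "A = B \<longleftrightarrow> A$1$1 = B$1$1 \<and> A$1$2 = B$1$2 \<and> A$2$1 = B$2$1 \<and> A$2$2 = B$2$2"
  for A B :: "'a^2^2"
  by (auto simp: vec_eq_iff forall_2)

lemma matrix_mult_2:
  fixes A B :: "complex^2^2"
  shows "(A ** B)$1$1 = A$1$1 * B$1$1 + A$1$2 * B$2$1" "(A ** B)$1$2 = A$1$1 * B$1$2 + A$1$2 * B$2$2"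
    "(A ** B)$2$1 = A$2$1 * B$1$1 + A$2$2 * B$2$1" "(A ** B)$2$2 = A$2$1 * B$1$2 + A$2$2 * B$2$2"
  by (simp_all add: matrix_matrix_mult_def sum_2)

lemma mat1_2:
  "(mat 1 :: complex^2^2)$1$1 = 1" "(mat 1 :: complex^2^2)$1$2 = 0"
  "(mat 1 :: complex^2^2)$2$1 = 0" "(mat 1 :: complex^2^2)$2$2 = 1"
  by (simp_all add: mat_def)

lemma continuous_on_mat2:
  assumes "continuous_on S a" "continuous_on S b" "continuous_on S c" "continuous_on S d"
  shows "continuous_on S (\<lambda>x. mat2 (a x) (b x) (c x) (d x))"
proof -
  have "mat2 (a x) (b x) (c x) (d x) =
      (\<chi> i j. if i = 1 then if j = 1 then a x else b x else if j = 1 then c x else d x)" for x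
    by (simp add: mat2_eq_iff)
  moreover have "continuous_on S (\<lambda>x. if i = 1 then if j = 1 then a x else b x else if j = 1 then c x else d x)"
    for i j :: 2
    using assms by (cases "i = 1"; cases "j = 1") auto
  then have "continuous_on S
      (\<lambda>x. (\<chi> i j. if i = 1 then if j = 1 then a x else b x else if j = 1 then c x else d x) :: complex^2^2)"
    by (intro continuous_on_vec_lambda)
  ultimately show ?thesis by presburger
qed

lemma SL2C_iff: "A \<in> SL2C \<longleftrightarrow> A$1$1 * A$2$2 - A$1$2 * A$2$1 = 1"
  by (simp add: SL2C_def det_2)

lemma SL2C_mult: "A \<in> SL2C \<Longrightarrow> B \<in> SL2C \<Longrightarrow> A ** B \<in> SL2C"
  by (simp add: SL2C_def det_mul)

lemma SL2C_one: "mat 1 \<in> SL2C"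
  by (simp add: SL2C_def)

lemma SL2C_inverse:
  assumes "A \<in> SL2C"
  shows "A ** matrix_inv A = mat 1" "matrix_inv A ** A = mat 1" "matrix_inv A \<in> SL2C"
    "matrix_inv A = mat2 (A$2$2) (- A$1$2) (- A$2$1) (A$1$1)"
proof -
  define B where "B = mat2 (A$2$2) (- A$1$2) (- A$2$1) (A$1$1)"
  have AB: "A ** B = mat 1 \<and> B ** A = mat 1"
    using assms by (simp add: SL2C_iff mat2_eq_iff matrix_mult_2 mat1_2 B_def algebra_simps)
  then have inv: "A ** matrix_inv A = mat 1 \<and> matrix_inv A ** A = mat 1"
    unfolding matrix_inv_def by (rule someI)
  then have "matrix_inv A = B"
    by (metis AB matrix_mul_assoc matrix_mul_lid matrix_mul_rid)
  moreover have "B \<in> SL2C" using assms by (simp add: SL2C_iff B_def algebra_simps)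
  ultimately show "A ** matrix_inv A = mat 1" "matrix_inv A ** A = mat 1" "matrix_inv A \<in> SL2C"
    "matrix_inv A = mat2 (A$2$2) (- A$1$2) (- A$2$1) (A$1$1)"
    using inv by (auto simp: B_def)
qed

lemma matrix_inv_SL2C_mult:
  assumes "A \<in> SL2C" "B \<in> SL2C"
  shows "matrix_inv (A ** B) = matrix_inv B ** matrix_inv A"
  using assms by (simp add: SL2C_inverse SL2C_mult mat2_eq_iff matrix_mult_2 algebra_simps)

lemma SL2C_mult_nonzero: "A \<in> SL2C \<Longrightarrow> \<kappa> \<noteq> 0 \<Longrightarrow> A *v \<kappa> \<noteq> 0"
  by (metis SL2C_inverse(2) matrix_vector_mul_assoc matrix_vector_mul_lid matrix_vector_mult_0_right)

lemma column_mult: "column 1 (A ** B) = A *v column 1 B"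
  by (simp add: column_def matrix_matrix_mult_def matrix_vector_mult_def)

lemma column_1_nonzero:
  assumes "A \<in> SL2C"
  shows "column 1 A \<noteq> 0"
  using assms by (auto simp: SL2C_iff column_def vec_eq_iff forall_2)

lemma bounded_linear_column: "bounded_linear (\<lambda>A::complex^2^2. column 1 A)"
  unfolding linear_conv_bounded_linear[symmetric]
  by (rule linearI; simp add: column_def vec_eq_iff)

text \<open>The trace is a class function, and the central elements $\pm 1$ are conjugate only to
themselves.\<close>

lemma parabolic_conjugate:
  assumes "A \<in> SL2C" "parabolic B"
  shows "parabolic (matrix_inv A ** B ** A)"
proof -
  let ?C = "matrix_inv A ** B ** A"
  have B: "B \<in> SL2C" "(trace B)\<^sup>2 = 4" "B \<noteq> mat 1" "B \<noteq> - mat 1"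
    using assms(2) by (auto simp: parabolic_def)
  have "trace ?C = trace (A ** (matrix_inv A ** B))"
    by (rule trace_mul_sym)
  then have tr: "trace ?C = trace B"
    using assms(1) by (simp add: matrix_mul_assoc SL2C_inverse(1))
  have conj_back: "A ** ?C ** matrix_inv A = B"
  proof -
    have "A ** ?C ** matrix_inv A = (A ** matrix_inv A) ** B ** (A ** matrix_inv A)"
      by (simp only: matrix_mul_assoc)
    then show ?thesis by (simp add: SL2C_inverse(1)[OF assms(1)])
  qed
  have neg: "A ** - mat 1 ** matrix_inv A = - (A ** matrix_inv A)"
    by (simp add: mat2_eq_iff matrix_mult_2 mat1_2)
  have "?C \<noteq> mat 1"
    using conj_back B(3) SL2C_inverse(1)[OF assms(1)] by auto
  moreover have "?C \<noteq> - mat 1"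
    using conj_back B(4) SL2C_inverse(1)[OF assms(1)] neg by metis
  ultimately show ?thesis
    using tr B assms(1) by (simp add: parabolic_def SL2C_mult SL2C_inverse(3))
qed

text \<open>A section of the map sending a matrix to its first column: for \<open>\<kappa> = (a, c)\<close>
the second column is $(-\bar c, \bar a)/|\kappa|^2$. The sum of a linear term and a scalar
multiple of a linear term is the form in which smoothness is immediate.\<close>

definition spinor_matrix :: "complex^2 \<Rightarrow> complex^2^2" where
  "spinor_matrix \<kappa> = mat2 (\<kappa>$1) 0 (\<kappa>$2) 0
     + inverse (\<kappa> \<bullet> \<kappa>) *\<^sub>R mat2 0 (- cnj (\<kappa>$2)) 0 (cnj (\<kappa>$1))"

lemma column_spinor_matrix: "column 1 (spinor_matrix \<kappa>) = \<kappa>"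
  by (simp add: spinor_matrix_def column_def vec_eq_iff forall_2)

lemma spinor_matrix_in_SL2C:
  assumes "\<kappa> \<noteq> 0"
  shows "spinor_matrix \<kappa> \<in> SL2C"
proof -
  have "\<kappa>$1 * cnj (\<kappa>$1) + \<kappa>$2 * cnj (\<kappa>$2) = complex_of_real (\<kappa> \<bullet> \<kappa>)"
    by (simp add: inner_vec_def sum_2 inner_complex_def complex_eq_iff algebra_simps)
  moreover have "inverse (\<kappa> \<bullet> \<kappa>) *\<^sub>R (\<kappa>$1 * cnj (\<kappa>$1) + \<kappa>$2 * cnj (\<kappa>$2)) =
    spinor_matrix \<kappa> $1$1 * spinor_matrix \<kappa> $2$2 - spinor_matrix \<kappa> $1$2 * spinor_matrix \<kappa> $2$1"
    by (simp add: spinor_matrix_def scaleR_add_right)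
  ultimately show ?thesis
    using assms by (simp add: SL2C_iff scaleR_conv_of_real)
qed

definition translation :: "complex \<Rightarrow> complex^2^2" where
  "translation b = mat2 1 b 0 1"

lemma translation_in_SL2C: "translation b \<in> SL2C"
  by (simp add: SL2C_iff translation_def)

lemma translation_0: "translation 0 = mat 1"
  by (simp add: translation_def mat2_eq_iff mat1_2)

lemma translation_mult: "translation a ** translation b = translation (a + b)"
  by (simp add: translation_def mat2_eq_iff matrix_mult_2)

lemma parabolic_subgroup_P_eq: "parabolic_subgroup_P = range translation"
  by (auto simp: parabolic_subgroup_P_def translation_def mat2_eq_iff image_iff)

lemma parabolic_translation: "b \<noteq> 0 \<Longrightarrow> parabolic (translation b)"
  using translation_in_SL2C[of b]
  by (auto simp: parabolic_def trace_def sum_2 translation_def mat2_eq_iff mat1_2)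

lemma column_translation: "column 1 (B ** translation b) = column 1 B"
proof -
  have "column 1 (translation b) = column 1 (mat 1)"
    by (simp add: column_def vec_eq_iff forall_2 translation_def mat1_2)
  then show ?thesis by (metis column_mult matrix_mul_rid)
qed

text \<open>Matrices with the same first column form a coset of the stabiliser $P$ of the spinor $(1,0)$.\<close>

lemma SL2C_same_first_column:
  assumes "A \<in> SL2C" "B \<in> SL2C" "column 1 A = column 1 B"
  obtains b where "A = B ** translation b"
proof -
  let ?C = "matrix_inv B ** A"
  have "column 1 ?C = column 1 (matrix_inv B ** B)"
    by (simp only: column_mult assms(3))
  then have col: "?C $1$1 = 1" "?C $2$1 = 0"
    by (simp_all add: SL2C_inverse(2)[OF assms(2)] column_def vec_eq_iff forall_2 mat1_2)
  have "?C \<in> SL2C" using assms by (simp add: SL2C_mult SL2C_inverse(3))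
  with col have "?C = translation (?C $1$2)"
    by (simp add: SL2C_iff translation_def mat2_eq_iff)
  moreover have "A = B ** ?C"
    by (simp add: matrix_mul_assoc SL2C_inverse(1)[OF assms(2)])
  ultimately show thesis using that by metis
qed

text \<open>The one-parameter group fixing the boundary points 1 and -1: it rotates about the geodesic
joining them, which passes through $(0,0,1)$ in the direction of the first axis. The parameter
is the angle of the rotation of the space, hence the half angles.\<close>

definition rotation :: "real \<Rightarrow> complex^2^2" where
  "rotation \<theta> = mat2 (cos (\<theta>/2)) (\<i> * sin (\<theta>/2)) (\<i> * sin (\<theta>/2)) (cos (\<theta>/2))"

lemma rotation_in_SL2C: "rotation \<theta> \<in> SL2C"
proof -
  have "complex_of_real (cos (\<theta>/2)) * cos (\<theta>/2) + complex_of_real (sin (\<theta>/2)) * sin (\<theta>/2) = 1"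
    unfolding of_real_mult[symmetric] of_real_add[symmetric]
    by (simp add: power2_eq_square[symmetric])
  then show ?thesis by (simp add: SL2C_iff rotation_def algebra_simps)
qed

section \<open>Moebius transformations of the upper half space\<close>

lemma open_U3: "open U3"
  unfolding U3_def by (intro open_Collect_less continuous_intros)

lemma mobius_height:
  "mobius A p $ 3 = p$3 / ((cmod (A$2$1 * Complex (p$1) (p$2) + A$2$2))\<^sup>2 + (cmod (A$2$1) * p$3)\<^sup>2)"
  by (simp add: mobius_def Let_def)

lemma mobius_denominator_pos:
  assumes "A \<in> SL2C" "p \<in> U3"
  shows "(cmod (A$2$1 * Complex (p$1) (p$2) + A$2$2))\<^sup>2 + (cmod (A$2$1) * p$3)\<^sup>2 > 0"
proof (cases "A$2$1 = 0")
  case True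
  then show ?thesis using assms by (auto simp: SL2C_iff)
next
  case False
  then show ?thesis using assms by (intro add_nonneg_pos) (auto simp: U3_def)
qed

lemma vector_3_axis:
  "vector [x, y, z] = x *\<^sub>R axis 1 1 + y *\<^sub>R axis 2 1 + z *\<^sub>R (axis 3 1 :: real^3)"
  by (simp add: vec_eq_iff forall_3 axis_def)

lemma bounded_linear_differentiable:
  assumes "bounded_linear f" "g differentiable (at x)"
  shows "(\<lambda>x. f (g x)) differentiable (at x)"
  using bounded_linear.has_derivative[OF assms(1)] assms(2) unfolding differentiable_def by blast

lemma mobius_differentiable:
  assumes "A \<in> SL2C" "p \<in> U3"
  shows "mobius A differentiable (at p)"
proof -
  have coord: "(\<lambda>p::real^3. p $ i) differentiable (at p)" for i
    by (rule bounded_linear_imp_differentiable[OF bounded_linear_vec_nth])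
  have of_real: "(\<lambda>p. complex_of_real (f p)) differentiable (at p)"
    if "f differentiable (at p)" for f :: "real^3 \<Rightarrow> real"
    by (rule bounded_linear_differentiable[OF bounded_linear_of_real that])
  have Re: "(\<lambda>p. Re (f p)) differentiable (at p)" and Im: "(\<lambda>p. Im (f p)) differentiable (at p)"
    and cnj: "(\<lambda>p. cnj (f p)) differentiable (at p)"
    if "f differentiable (at p)" for f :: "real^3 \<Rightarrow> complex"
    using that by (intro bounded_linear_differentiable[OF bounded_linear_Re]
        bounded_linear_differentiable[OF bounded_linear_Im]
        bounded_linear_differentiable[OF bounded_linear_cnj]; assumption)+
  have axis: "(\<lambda>p. f p *\<^sub>R v) differentiable (at p)"
    if "f differentiable (at p)" for f :: "real^3 \<Rightarrow> real" and v :: "real^3"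
    using that by (intro differentiable_scaleR) auto
  define z where "z = (\<lambda>p::real^3. Complex (p$1) (p$2))"
  define n where "n = (\<lambda>p. (cmod (A$2$1 * z p + A$2$2))\<^sup>2 + (cmod (A$2$1) * p$3)\<^sup>2)"
  define w where "w = (\<lambda>p. ((A$1$1 * z p + A$1$2) * cnj (A$2$1 * z p + A$2$2)
    + A$1$1 * cnj (A$2$1) * complex_of_real ((p$3)\<^sup>2)) / complex_of_real (n p))"
  have z: "z differentiable (at p)"
    unfolding z_def Complex_eq
    by (intro differentiable_add differentiable_mult differentiable_const of_real coord)
  have n: "n differentiable (at p)"
    unfolding n_def cmod_power2 power_mult_distrib
    by (intro differentiable_add differentiable_mult differentiable_const differentiable_power
        Re Im coord z)
  have "n p > 0"
    unfolding n_def z_def by (rule mobius_denominator_pos[OF assms])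
  then have n0: "n p \<noteq> 0" by simp
  have w: "w differentiable (at p)"
    unfolding w_def
    by (intro differentiable_divide differentiable_add differentiable_mult differentiable_const
        differentiable_power cnj of_real coord z n) (simp add: n0)
  have t: "(\<lambda>p. p$3 / n p) differentiable (at p)"
    by (intro differentiable_divide coord n n0)
  have "mobius A = (\<lambda>p. Re (w p) *\<^sub>R axis 1 1 + Im (w p) *\<^sub>R axis 2 1 + (p$3 / n p) *\<^sub>R axis 3 1)"
    by (simp add: fun_eq_iff mobius_def Let_def vector_3_axis w_def n_def z_def)
  then show ?thesis
    by (simp only:) (intro differentiable_add axis Re Im w t)
qed

lemma continuous_on_mobius: "A \<in> SL2C \<Longrightarrow> continuous_on U3 (mobius A)"
  by (intro continuous_at_imp_continuous_on ballI differentiable_imp_continuous_within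
      mobius_differentiable)

lemma mobius_deriv_has_derivative:
  assumes "A \<in> SL2C" "p \<in> U3"
  shows "(mobius A has_derivative mobius_deriv A p) (at p)"
  unfolding mobius_deriv_def using mobius_differentiable[OF assms] frechet_derivative_works by blast

lemma linear_mobius_deriv: "A \<in> SL2C \<Longrightarrow> p \<in> U3 \<Longrightarrow> linear (mobius_deriv A p)"
  using mobius_deriv_has_derivative has_derivative_linear by blast

lemma mobius_derivI: "(mobius A has_derivative D) (at p) \<Longrightarrow> mobius_deriv A p = D"
  unfolding mobius_deriv_def using frechet_derivative_at by metis

text \<open>The hypotheses hold for upper triangular matrices with diagonal entries both 1 or both -1, which
covers the translations and all parabolic elements that preserve a horizontal plane.\<close>

lemma mobius_upper_triangular:
  assumes "A$2$1 = 0" "A$1$1 * cnj (A$2$2) = 1" "cmod (A$2$2) = 1"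
  shows "mobius A p = p + vector [Re (A$1$2 * cnj (A$2$2)), Im (A$1$2 * cnj (A$2$2)), 0]"
proof -
  have "(A$1$1 * Complex (p$1) (p$2) + A$1$2) * cnj (A$2$2) =
    (A$1$1 * cnj (A$2$2)) * Complex (p$1) (p$2) + A$1$2 * cnj (A$2$2)"
    by (simp add: algebra_simps)
  with assms show ?thesis
    by (simp add: mobius_def Let_def vec_eq_iff forall_3 del: times_complex.sel)
qed

lemma mobius_deriv_upper_triangular:
  assumes "A$2$1 = 0" "A$1$1 * cnj (A$2$2) = 1" "cmod (A$2$2) = 1"
  shows "mobius_deriv A p x = x"
proof -
  have "mobius A = (\<lambda>p. p + vector [Re (A$1$2 * cnj (A$2$2)), Im (A$1$2 * cnj (A$2$2)), 0])"
    using mobius_upper_triangular[OF assms] by blast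
  then have "(mobius A has_derivative (\<lambda>x. x)) (at p)"
    by (auto intro!: derivative_eq_intros)
  then show ?thesis by (simp add: mobius_derivI)
qed

lemma mobius_translation: "mobius (translation b) p = p + vector [Re b, Im b, 0]"
  by (simp add: mobius_upper_triangular translation_def)

lemma mobius_deriv_translation: "mobius_deriv (translation b) p x = x"
  by (simp add: mobius_deriv_upper_triangular translation_def)

definition base_point :: "real^3" where
  "base_point = vector [0, 0, 1]"

lemma base_point_in_U3: "base_point \<in> U3"
  by (simp add: base_point_def U3_def)

lemma has_derivative_nth [derivative_intros]:
  "(f has_derivative f') F \<Longrightarrow> ((\<lambda>x. f x $ i) has_derivative (\<lambda>h. f' h $ i)) F"
  by (rule bounded_linear.has_derivative[OF bounded_linear_vec_nth])

text \<open>The base point lies on the axis of this rotation, so the differential there is a linear rotation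
about the direction of the axis.\<close>

lemma mobius_rotation: "mobius (rotation \<theta>) base_point = base_point"
  and mobius_deriv_rotation: "mobius_deriv (rotation \<theta>) base_point u =
    vector [u$1, cos \<theta> * u$2 - sin \<theta> * u$3, sin \<theta> * u$2 + cos \<theta> * u$3]"
proof -
  define C S where "C = cos (\<theta>/2)" and "S = sin (\<theta>/2)"
  have CS: "C\<^sup>2 + S\<^sup>2 = 1" by (simp add: C_def S_def)
  have trig: "cos \<theta> = C\<^sup>2 - S\<^sup>2" "sin \<theta> = 2 * S * C"
    using cos_double[of "\<theta>/2"] sin_double[of "\<theta>/2"] by (simp_all add: C_def S_def)
  define n :: "real^3 \<Rightarrow> real" where "n p = (C - S * p$2)\<^sup>2 + (S * p$1)\<^sup>2 + (S * p$3)\<^sup>2" for p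
  \<comment> \<open>The matrix has entries \<open>C\<close> and \<open>\<i> S\<close> with real \<open>C\<close>, \<open>S\<close>, so the quaternionic formula
    separates into real rational functions with common denominator \<open>n\<close>.\<close>
  have m: "mobius (rotation \<theta>) = (\<lambda>p. ((C\<^sup>2 + S\<^sup>2) * p$1 / n p) *\<^sub>R axis 1 1
     + (((C * p$2 + S) * (C - S * p$2) - C * S * ((p$1)\<^sup>2 + (p$3)\<^sup>2)) / n p) *\<^sub>R axis 2 1
     + (p$3 / n p) *\<^sub>R axis 3 1)"
    by (simp add: fun_eq_iff mobius_def Let_def vec_eq_iff forall_3 axis_def rotation_def n_def
        C_def[symmetric] S_def[symmetric] cmod_power2 Re_divide_of_real Im_divide_of_real norm_mult)
      (simp add: power2_eq_square algebra_simps)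
  have n1: "n base_point = 1"
    using CS by (simp add: n_def base_point_def)
  show "mobius (rotation \<theta>) base_point = base_point"
    unfolding m n1 by (simp add: base_point_def CS vec_eq_iff forall_3 axis_def)
  have dn: "(n has_derivative (\<lambda>u. - 2 * C * S * u$2 + 2 * S\<^sup>2 * u$3)) (at base_point)"
    unfolding n_def
    by (auto intro!: derivative_eq_intros simp: base_point_def fun_eq_iff power2_eq_square algebra_simps)
  \<comment> \<open>Since \<open>n\<close> is 1 at the base point, the quotient rule takes the form \<open>f' - f n'\<close> there.\<close>
  have quotient: "((\<lambda>p. f p / n p) has_derivative
      (\<lambda>u. f' u - f base_point * (- 2 * C * S * u$2 + 2 * S\<^sup>2 * u$3))) (at base_point)"
    if "(f has_derivative f') (at base_point)" for f f'
    using has_derivative_divide'[OF that dn] n1 by simp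
  have "((\<lambda>p. (C\<^sup>2 + S\<^sup>2) * p$1) has_derivative (\<lambda>u. u$1)) (at base_point)"
    unfolding CS by (auto intro!: derivative_eq_intros)
  from quotient[OF this]
  have "((\<lambda>p. (C\<^sup>2 + S\<^sup>2) * p$1 / n p) has_derivative (\<lambda>u. u$1)) (at base_point)"
    by (simp add: base_point_def)
  moreover have "((\<lambda>p. (C * p$2 + S) * (C - S * p$2) - C * S * ((p$1)\<^sup>2 + (p$3)\<^sup>2))
      has_derivative (\<lambda>u. (C\<^sup>2 - S\<^sup>2) * u$2 - 2 * S * C * u$3)) (at base_point)"
    by (auto intro!: derivative_eq_intros simp: base_point_def power2_eq_square algebra_simps)
  from quotient[OF this]
  have "((\<lambda>p. ((C * p$2 + S) * (C - S * p$2) - C * S * ((p$1)\<^sup>2 + (p$3)\<^sup>2)) / n p)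
      has_derivative (\<lambda>u. (C\<^sup>2 - S\<^sup>2) * u$2 - 2 * S * C * u$3)) (at base_point)"
    by (simp add: base_point_def)
  moreover have "((\<lambda>p. p$3 / n p) has_derivative
      (\<lambda>u. 2 * S * C * u$2 + (C\<^sup>2 - S\<^sup>2) * u$3)) (at base_point)"
  proof -
    have C2: "C\<^sup>2 = 1 - S\<^sup>2" using CS by simp
    have "(\<lambda>u. 2 * S * C * u$2 + (C\<^sup>2 - S\<^sup>2) * u$3) =
        (\<lambda>u::real^3. u$3 - (- 2 * C * S * u$2 + 2 * S\<^sup>2 * u$3))"
      unfolding C2 by (simp add: fun_eq_iff algebra_simps)
    then show ?thesis
      using quotient[OF has_derivative_nth[OF has_derivative_ident], of 3]
      by (simp add: base_point_def)
  qed
  ultimately have "(mobius (rotation \<theta>) has_derivative (\<lambda>u. u$1 *\<^sub>R axis 1 1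
     + ((C\<^sup>2 - S\<^sup>2) * u$2 - 2 * S * C * u$3) *\<^sub>R axis 2 1
     + (2 * S * C * u$2 + (C\<^sup>2 - S\<^sup>2) * u$3) *\<^sub>R axis 3 1)) (at base_point)"
    unfolding m by (intro has_derivative_add has_derivative_scaleR_left)
  then show "mobius_deriv (rotation \<theta>) base_point u =
    vector [u$1, cos \<theta> * u$2 - sin \<theta> * u$3, sin \<theta> * u$2 + cos \<theta> * u$3]"
    by (simp add: mobius_derivI trig vec_eq_iff forall_3 axis_def)
qed

section \<open>Horospheres as level sets\<close>

text \<open>The logarithm of this is a Busemann function of the boundary point \<open>\<kappa>$1 /
\<kappa>$2\<close>; the size of the spinor fixes the additive constant.\<close>

definition horofunction :: "complex^2 \<Rightarrow> real^3 \<Rightarrow> real" where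
  "horofunction \<kappa> p =
     ((cmod (\<kappa>$1 - \<kappa>$2 * Complex (p$1) (p$2)))\<^sup>2 + (cmod (\<kappa>$2) * p$3)\<^sup>2) / p$3"

text \<open>The second row of the inverse matrix is formed from the first column of \<open>A\<close>. This
is what makes the function equivariant without any computation.\<close>

lemma horofunction_eq_inverse_height:
  assumes "A \<in> SL2C"
  shows "horofunction (column 1 A) p = 1 / (mobius (matrix_inv A) p $ 3)"
  using assms by (simp add: SL2C_inverse mobius_height horofunction_def column_def)

definition spinor_centre :: "complex^2 \<Rightarrow> ideal_point" where
  "spinor_centre \<kappa> = (if \<kappa>$2 = 0 then Infinite_Point else Finite_Point (\<kappa>$1 / \<kappa>$2))"

definition spinor_radius :: "complex^2 \<Rightarrow> real" where
  "spinor_radius \<kappa> = (if \<kappa>$2 = 0 then (cmod (\<kappa>$1))\<^sup>2 else 1 / (2 * (cmod (\<kappa>$2))\<^sup>2))"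

lemma spinor_radius_pos: "\<kappa> \<noteq> 0 \<Longrightarrow> spinor_radius \<kappa> > 0"
  by (auto simp: spinor_radius_def vec_eq_iff forall_2)

lemma horosphere_spinor_exists:
  assumes "r > 0"
  obtains \<kappa> where "\<kappa> \<noteq> 0" "spinor_centre \<kappa> = \<xi>" "spinor_radius \<kappa> = r"
proof (cases \<xi>)
  case (Finite_Point w)
  define c where "c = complex_of_real (1 / sqrt (2 * r))"
  have "c \<noteq> 0" "(cmod c)\<^sup>2 = 1 / (2 * r)"
    using assms by (auto simp: c_def power_divide norm_divide)
  then show thesis
    using assms by (intro that[of "vector [w * c, c]"])
      (auto simp: Finite_Point spinor_centre_def spinor_radius_def vec_eq_iff forall_2)
next
  case Infinite_Point
  then show thesis
    using assms by (intro that[of "vector [complex_of_real (sqrt r), 0]"])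
      (auto simp: spinor_centre_def spinor_radius_def vec_eq_iff forall_2)
qed

lemma horosphere_subset_U3: "r > 0 \<Longrightarrow> horosphere \<xi> r \<subseteq> U3"
  by (cases \<xi>) (auto simp: U3_def)

lemma horofunction_finite:
  assumes "\<kappa>$2 \<noteq> 0"
  shows "horofunction \<kappa> p = (cmod (\<kappa>$2))\<^sup>2 * ((p$1 - Re (\<kappa>$1 / \<kappa>$2))\<^sup>2
    + (p$2 - Im (\<kappa>$1 / \<kappa>$2))\<^sup>2 + (p$3)\<^sup>2) / p$3"
proof -
  have "\<kappa>$1 - \<kappa>$2 * Complex (p$1) (p$2) = \<kappa>$2 * (\<kappa>$1 / \<kappa>$2 - Complex (p$1) (p$2))"
    using assms by (simp add: algebra_simps)
  then have "(cmod (\<kappa>$1 - \<kappa>$2 * Complex (p$1) (p$2)))\<^sup>2 = (cmod (\<kappa>$2))\<^sup>2 *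
      ((Re (\<kappa>$1 / \<kappa>$2) - p$1)\<^sup>2 + (Im (\<kappa>$1 / \<kappa>$2) - p$2)\<^sup>2)"
    by (simp only: norm_mult power_mult_distrib cmod_power2) simp
  then show ?thesis
    by (simp add: horofunction_def power_mult_distrib power2_commute algebra_simps)
qed

lemma sphere_3_iff:
  fixes p :: "real^3"
  shows "p \<in> sphere (vector [x, y, z]) r \<longleftrightarrow> 0 \<le> r \<and> (p$1 - x)\<^sup>2 + (p$2 - y)\<^sup>2 + (p$3 - z)\<^sup>2 = r\<^sup>2"
proof -
  have "(dist (vector [x, y, z]) p)\<^sup>2 = (p$1 - x)\<^sup>2 + (p$2 - y)\<^sup>2 + (p$3 - z)\<^sup>2"
    unfolding dist_norm power2_norm_eq_inner
    by (simp add: inner_vec_def sum_3) (simp add: power2_eq_square algebra_simps)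
  then show ?thesis
    by (metis mem_sphere power2_eq_iff_nonneg zero_le_dist)
qed

text \<open>For a finite centre \<open>(a, b)\<close>, the condition is $c\,((x-a)^2 + (y-b)^2 + t^2) = t$
with $c = |\kappa_2|^2$; completing the square in $t$ gives the sphere of radius $1/(2c)$
tangent to the boundary.\<close>

lemma horosphere_eq_level_set:
  assumes "\<kappa> \<noteq> 0"
  shows "horosphere (spinor_centre \<kappa>) (spinor_radius \<kappa>) = {p \<in> U3. horofunction \<kappa> p = 1}"
proof (cases "\<kappa>$2 = 0")
  case True
  then have "\<kappa>$1 \<noteq> 0" using assms by (auto simp: vec_eq_iff forall_2)
  with True show ?thesis
    by (auto simp: spinor_centre_def spinor_radius_def horofunction_def U3_def field_simps)
next
  case False
  define a b c where "a = Re (\<kappa>$1 / \<kappa>$2)" and "b = Im (\<kappa>$1 / \<kappa>$2)" and "c = (cmod (\<kappa>$2))\<^sup>2"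
  have "c > 0" using False by (simp add: c_def)
  have "(p \<in> sphere (vector [a, b, 1 / (2 * c)]) (1 / (2 * c))) = (horofunction \<kappa> p = 1)"
    if "p \<in> U3" for p
  proof -
    define D where "D = (p$1 - a)\<^sup>2 + (p$2 - b)\<^sup>2"
    have "(D + (p$3 - 1 / (2 * c))\<^sup>2 = (1 / (2 * c))\<^sup>2) = (c * (D + (p$3)\<^sup>2) = p$3)"
    proof -
      have "c * (D + (p$3 - 1 / (2 * c))\<^sup>2 - (1 / (2 * c))\<^sup>2) = c * (D + (p$3)\<^sup>2) - p$3"
        using \<open>c > 0\<close> by (simp add: power2_eq_square field_simps)
      then show ?thesis using \<open>c > 0\<close> by (metis diff_self mult_eq_0_iff right_minus_eq less_irrefl)
    qed
    with \<open>c > 0\<close> that show ?thesis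
      unfolding sphere_3_iff horofunction_finite[OF False]
        a_def[symmetric] b_def[symmetric] c_def[symmetric] D_def
      by (auto simp: U3_def)
  qed
  then show ?thesis
    using False by (auto simp: spinor_centre_def spinor_radius_def a_def b_def c_def)
qed

text \<open>The logarithm of the function decreases at unit speed along the geodesics to the centre, so on
the level 1 its hyperbolic gradient is the unit normal pointing away from the centre.\<close>

lemma horofunction_gradient:
  assumes "\<kappa> \<noteq> 0" and "p \<in> U3" and "horofunction \<kappa> p = 1"
  shows "(horofunction \<kappa> has_derivative
    (\<lambda>u. - hyp_inner p u (N_out (spinor_centre \<kappa>) (spinor_radius \<kappa>) p))) (at p)"
proof (cases "\<kappa>$2 = 0")
  case True
  define a where "a = (cmod (\<kappa>$1))\<^sup>2"
  have p3: "p$3 = a" "p$3 > 0"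
    using assms True by (auto simp: horofunction_def a_def U3_def field_simps)
  have "((\<lambda>p. a / p$3) has_derivative
    (\<lambda>u. - hyp_inner p u (vector [0, 0, p$3]))) (at p)"
    using p3 by (auto intro!: derivative_eq_intros
      simp: hyp_inner_def inner_vec_def sum_3 field_simps power2_eq_square)
  moreover have "horofunction \<kappa> = (\<lambda>p. a / p$3)"
    using True by (auto simp: horofunction_def a_def)
  ultimately show ?thesis using True by (simp add: spinor_centre_def)
next
  case False
  define a b c where "a = Re (\<kappa>$1 / \<kappa>$2)" and "b = Im (\<kappa>$1 / \<kappa>$2)" and "c = (cmod (\<kappa>$2))\<^sup>2"
  have c: "c > 0" using False by (simp add: c_def)
  have p3: "p$3 > 0" using assms by (simp add: U3_def)
  have h: "horofunction \<kappa> = (\<lambda>p. c * ((p$1 - a)\<^sup>2 + (p$2 - b)\<^sup>2 + (p$3)\<^sup>2) / p$3)"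
    using horofunction_finite[OF False] by (auto simp: a_def b_def c_def)
  have lev: "c * ((p$1 - a)\<^sup>2 + (p$2 - b)\<^sup>2 + (p$3)\<^sup>2) = p$3"
    using assms(3) p3 by (simp add: h)
  \<comment> \<open>The numerator in the quotient rule is kept intact, so that \<open>lev\<close> can replace it by \<open>p$3\<close>.\<close>
  have "((\<lambda>p. c * ((p$1 - a)\<^sup>2 + (p$2 - b)\<^sup>2 + (p$3)\<^sup>2) / p$3) has_derivative
    (\<lambda>u. (c * (2 * (p$1 - a) * u$1 + 2 * (p$2 - b) * u$2 + 2 * p$3 * u$3) * p$3
      - (c * ((p$1 - a)\<^sup>2 + (p$2 - b)\<^sup>2 + (p$3)\<^sup>2)) * u$3) / (p$3)\<^sup>2)) (at p)"
    using p3 by (auto intro!: derivative_eq_intros simp: field_simps power2_eq_square)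
  then have "(horofunction \<kappa> has_derivative
    (\<lambda>u. (c * (2 * (p$1 - a) * u$1 + 2 * (p$2 - b) * u$2 + 2 * p$3 * u$3) * p$3
      - p$3 * u$3) / (p$3)\<^sup>2)) (at p)" (is "(_ has_derivative ?D) _")
    unfolding h lev .
  moreover have "?D = (\<lambda>u. - hyp_inner p u (N_out (spinor_centre \<kappa>) (spinor_radius \<kappa>) p))"
  proof -
    have N: "N_out (spinor_centre \<kappa>) (spinor_radius \<kappa>) p
        = (p$3 * (2 * c)) *\<^sub>R (vector [a, b, 1 / (2 * c)] - p)"
      using False by (simp add: spinor_centre_def spinor_radius_def a_def b_def c_def)
    show ?thesis
      unfolding N using p3 c
      by (auto simp: hyp_inner_def inner_vec_def sum_3 field_simps power2_eq_square)
  qed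
  ultimately show ?thesis by simp
qed

text \<open>The vertical component of the normal at height $t$ is $t(r-t)/r$ for a finite centre, which
recovers the radius, and $t$ for the centre at infinity, a value that no finite centre attains.\<close>

lemma horosphere_determined_by_normal:
  assumes "p \<in> horosphere \<xi> r" "p \<in> horosphere \<xi>' r'" "r > 0" "r' > 0"
    and N: "N_out \<xi> r p = N_out \<xi>' r' p"
  shows "\<xi> = \<xi>' \<and> r = r'"
proof -
  have p3: "p$3 > 0"
    using assms(1,3) by (cases \<xi>) (auto simp: U3_def)
  have c: "N_out \<xi> r p $ i = N_out \<xi>' r' p $ i" for i using N by simp
  show ?thesis
    using assms(1-4) p3 c[of 1] c[of 2] c[of 3]
    by (cases \<xi>; cases \<xi>') (auto simp: field_simps complex_eq_iff)
qed

section \<open>Orthonormal frames\<close>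

lemma hyp_inner_simps:
  "hyp_inner p (u + v) w = hyp_inner p u w + hyp_inner p v w"
  "hyp_inner p u (v + w) = hyp_inner p u v + hyp_inner p u w"
  "hyp_inner p (c *\<^sub>R u) v = c * hyp_inner p u v"
  "hyp_inner p u (c *\<^sub>R v) = c * hyp_inner p u v"
  "hyp_inner p (- u) v = - hyp_inner p u v"
  "hyp_inner p u (- v) = - hyp_inner p u v"
  "hyp_inner p (u - v) w = hyp_inner p u w - hyp_inner p v w"
  "hyp_inner p u (v - w) = hyp_inner p u v - hyp_inner p u w"
  by (simp_all add: hyp_inner_def inner_simps add_divide_distrib diff_divide_distrib)

lemma hyp_inner_commute: "hyp_inner p u v = hyp_inner p v u"
  by (simp add: hyp_inner_def inner_commute)

lemma hyp_inner_pos: "p \<in> U3 \<Longrightarrow> u \<noteq> 0 \<Longrightarrow> hyp_inner p u u > 0"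
  by (simp add: hyp_inner_def U3_def)

lemma hyp_inner_eq_zero: "p \<in> U3 \<Longrightarrow> hyp_inner p u u = 0 \<Longrightarrow> u = 0"
  using hyp_inner_pos by fastforce

lemma hyp_cross_simps:
  "hyp_cross p u (v + w) = hyp_cross p u v + hyp_cross p u w"
  "hyp_cross p u (c *\<^sub>R v) = c *\<^sub>R hyp_cross p u v"
  "hyp_cross p u u = 0"
  by (simp_all add: hyp_cross_def cross_add_right cross_mult_right scaleR_add_right)

text \<open>A right-handed frame is determined by its first two vectors, and any two orthonormal vectors
occur. This turns statements about frames into statements about the metric and the cross
product, and back.\<close>

lemma frame_iff:
  "(p, e1, e2, e3) \<in> frames \<longleftrightarrow> p \<in> U3 \<and> hyp_inner p e1 e1 = 1 \<and> hyp_inner p e2 e2 = 1 \<and>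
     hyp_inner p e1 e2 = 0 \<and> e3 = hyp_cross p e1 e2"
proof (cases "p \<in> U3 \<and> hyp_inner p e1 e1 = 1 \<and> hyp_inner p e2 e2 = 1 \<and> hyp_inner p e1 e2 = 0")
  case True
  define t where "t = p$3"
  have t: "t > 0" using True by (simp add: U3_def t_def)
  have e: "e1 \<bullet> e1 = t\<^sup>2" "e2 \<bullet> e2 = t\<^sup>2" "e1 \<bullet> e2 = 0"
    using True t by (auto simp: hyp_inner_def t_def[symmetric] field_simps)
  define c where "c = hyp_cross p e1 e2"
  have cross: "cross3 e1 e2 = t *\<^sub>R c" using t by (simp add: c_def hyp_cross_def t_def[symmetric])
  have "cross3 e1 e2 \<bullet> cross3 e1 e2 = t\<^sup>2 * t\<^sup>2"
    using norm_cross_dot[of e1 e2] by (simp add: power2_norm_eq_inner power_mult_distrib e)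
  then have "t\<^sup>2 * (c \<bullet> c) = t\<^sup>2 * t\<^sup>2"
    by (simp only: cross inner_scaleR_left inner_scaleR_right power2_eq_square mult.assoc)
  then have cc: "c \<bullet> c = t\<^sup>2"
    using t by (metis mult_left_cancel power_eq_0_iff less_irrefl)
  have c_orth: "e1 \<bullet> c = 0" "e2 \<bullet> c = 0"
    using dot_cross_self(1,2)[of e1 e2] dot_cross_self(1,2)[of e2 e1] t by (auto simp: c_def hyp_cross_def)
  have "cross3 e1 e2 \<bullet> c > 0"
    using t by (simp add: cross cc)
  then have "(p, e1, e2, c) \<in> frames"
    using True t cc c_orth
    by (auto simp: frames_def hyp_inner_def t_def[symmetric])
  moreover have "e3 = c" if "(p, e1, e2, e3) \<in> frames"
  proof -
    have x: "e3 \<bullet> e3 = t\<^sup>2" "e2 \<bullet> e3 = 0" "e1 \<bullet> e3 = 0" "c \<bullet> e3 > 0"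
      using that t by (auto simp: frames_def hyp_inner_def cross t_def[symmetric] field_simps zero_less_mult_iff)
    \<comment> \<open>The vector \<open>e3\<close> is orthogonal to both \<open>e1\<close> and \<open>e2\<close>, hence parallel to their cross product.\<close>
    have "cross3 (t *\<^sub>R c) e3 = 0"
      unfolding cross[symmetric] by (simp add: cross_skew[of _ e3] Lagrange x inner_commute)
    then have "cross3 c e3 = 0" using t by (simp add: cross_mult_left)
    then have "(c \<bullet> e3)\<^sup>2 = (t\<^sup>2)\<^sup>2"
      using norm_cross_dot[of c e3]
      by (simp add: power2_norm_eq_inner power_mult_distrib x cc)
    then have "c \<bullet> e3 = t\<^sup>2"
      by (rule power2_eq_imp_eq) (use x(4) in auto)
    then have "(e3 - c) \<bullet> (e3 - c) = 0"
      by (simp add: inner_diff inner_commute x cc)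
    then show ?thesis by simp
  qed
  ultimately show ?thesis using True by (auto simp: c_def)
next
  case False
  then show ?thesis by (auto simp: frames_def)
qed

lemma unit_vector_in_frame:
  assumes "p \<in> U3" "hyp_inner p u u = 1"
  obtains v where "(p, u, v, hyp_cross p u v) \<in> frames"
proof -
  have "2 \<le> DIM(real^3)" by simp
  then obtain w :: "real^3" where w: "w \<noteq> 0" "orthogonal u w"
    using orthogonal_to_vector_exists[of u] by metis
  have h: "hyp_inner p w w > 0" using hyp_inner_pos assms(1) w(1) by blast
  show thesis
    by (rule that[of "(1 / sqrt (hyp_inner p w w)) *\<^sub>R w"])
      (use h assms w in \<open>auto simp: frame_iff hyp_inner_simps hyp_inner_def orthogonal_def\<close>)
qed

lemma scaled_unit_vector:
  assumes "p \<in> U3"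
  obtains c u where "x = c *\<^sub>R u" "hyp_inner p u u = 1"
proof (cases "x = 0")
  case True
  have "p$3 > 0" using assms by (simp add: U3_def)
  then have "hyp_inner p (p$3 *\<^sub>R axis 1 1) (p$3 *\<^sub>R axis 1 1) = 1"
    by (simp add: hyp_inner_def inner_axis_axis power2_eq_square)
  then show thesis using that[of 0] True by simp
next
  case False
  then have h: "hyp_inner p x x > 0" using hyp_inner_pos assms by blast
  show thesis
    by (rule that[of "sqrt (hyp_inner p x x)" "(1 / sqrt (hyp_inner p x x)) *\<^sub>R x"])
      (use h in \<open>auto simp: hyp_inner_simps\<close>)
qed

text \<open>The frame at the base point whose second vector is the first axis, the others being turned about
it by \<open>\<theta>\<close>. Angle 0 gives the inward frame of the plane at height 1, and
angle $-\pi$ the outward one.\<close>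

definition base_frame :: "real \<Rightarrow> frame" where
  "base_frame \<theta> = (base_point, vector [0, sin \<theta>, - cos \<theta>], vector [1, 0, 0],
    vector [0, - cos \<theta>, - sin \<theta>])"

lemma base_frame_in_frames: "base_frame \<theta> \<in> frames"
proof -
  have "cos \<theta> * cos \<theta> + sin \<theta> * sin \<theta> = 1" "sin \<theta> * sin \<theta> + cos \<theta> * cos \<theta> = 1"
    by (simp_all add: power2_eq_square[symmetric])
  then show ?thesis
    unfolding base_frame_def frame_iff using base_point_in_U3
    by (simp add: hyp_inner_def hyp_cross_def) (simp add: base_point_def inner_vec_def sum_3 cross3_def)
qed

lemma frame_act_rotation: "frame_act (rotation \<theta>) (base_frame 0) = base_frame \<theta>"
  by (simp add: base_frame_def frame_act_def mobius_rotation mobius_deriv_rotation)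

lemma rotate_frame_base_frame:
  "rotate_frame (vector [1, 0, 0]) \<theta> (base_frame \<phi>) = base_frame (\<theta> + \<phi>)"
  by (simp add: base_frame_def rotate_frame_def rotate_vec_def hyp_cross_def hyp_inner_def
      base_point_def cross3_def inner_vec_def sum_3 vec_eq_iff forall_3 cos_add sin_add algebra_simps)

section \<open>Isometries from the spin frame bundle\<close>

text \<open>The bundle carries a lift of the action on frames. Since every frame lies under some spin frame,
the group laws and the preservation of frames hold downstairs as well.\<close>

locale spin_frames =
  fixes E :: "'e::topological_space set" and pr :: "'e \<Rightarrow> frame" and act :: "complex^2^2 \<Rightarrow> 'e \<Rightarrow> 'e"
  assumes is_spin_frame_bundle: "spin_frame_bundle E pr act"
begin

lemma covering: "covering_space E pr frames"
  using is_spin_frame_bundle by (simp add: spin_frame_bundle_def)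

lemma act_in_E: "A \<in> SL2C \<Longrightarrow> e \<in> E \<Longrightarrow> act A e \<in> E"
  using is_spin_frame_bundle by (simp add: spin_frame_bundle_def)

lemma pr_act: "A \<in> SL2C \<Longrightarrow> e \<in> E \<Longrightarrow> pr (act A e) = frame_act A (pr e)"
  using is_spin_frame_bundle by (simp add: spin_frame_bundle_def)

lemma act_one: "e \<in> E \<Longrightarrow> act (mat 1) e = e"
  using is_spin_frame_bundle by (simp add: spin_frame_bundle_def)

lemma act_mult: "A \<in> SL2C \<Longrightarrow> B \<in> SL2C \<Longrightarrow> e \<in> E \<Longrightarrow> act (A ** B) e = act A (act B e)"
  using is_spin_frame_bundle by (simp add: spin_frame_bundle_def)

lemma continuous_on_act:
  assumes "continuous_on S g" "continuous_on S h" "\<And>x. x \<in> S \<Longrightarrow> g x \<in> SL2C" "\<And>x. x \<in> S \<Longrightarrow> h x \<in> E"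
  shows "continuous_on S (\<lambda>x. act (g x) (h x))"
proof -
  have "continuous_on (SL2C \<times> E) (\<lambda>(A, e). act A e)"
    using is_spin_frame_bundle by (simp add: spin_frame_bundle_def)
  from continuous_on_compose2[OF this continuous_on_Pair[OF assms(1,2)]] show ?thesis
    using assms(3,4) by auto
qed

lemma act_simply_transitive: "e \<in> E \<Longrightarrow> e' \<in> E \<Longrightarrow> \<exists>!A. A \<in> SL2C \<and> act A e = e'"
  using is_spin_frame_bundle by (simp add: spin_frame_bundle_def)

lemma act_inverse: "A \<in> SL2C \<Longrightarrow> e \<in> E \<Longrightarrow> act (matrix_inv A) (act A e) = e"
  by (metis SL2C_inverse(2,3) act_mult act_one)

lemma frame_lift_exists: "f \<in> frames \<Longrightarrow> \<exists>e\<in>E. pr e = f"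
  using covering_space_imp_surjective[OF covering] by (metis imageE)

lemma pr_in_frames: "e \<in> E \<Longrightarrow> pr e \<in> frames"
  using covering_space_imp_surjective[OF covering] by auto

lemma frame_act_in_frames: "A \<in> SL2C \<Longrightarrow> f \<in> frames \<Longrightarrow> frame_act A f \<in> frames"
  by (metis frame_lift_exists act_in_E pr_act pr_in_frames)

lemma frame_act_mult:
  "A \<in> SL2C \<Longrightarrow> B \<in> SL2C \<Longrightarrow> f \<in> frames \<Longrightarrow> frame_act (A ** B) f = frame_act A (frame_act B f)"
  by (metis frame_lift_exists act_in_E pr_act act_mult SL2C_mult)

lemma frame_act_one: "f \<in> frames \<Longrightarrow> frame_act (mat 1) f = f"
  by (metis frame_lift_exists pr_act act_one SL2C_one)

text \<open>Every point carries a frame, so statements about frames restrict to base points.\<close>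

lemma frame_at_point: "p \<in> U3 \<Longrightarrow> \<exists>u v w. (p, u, v, w) \<in> frames"
  by (metis scaled_unit_vector unit_vector_in_frame)

lemma mobius_in_U3: "A \<in> SL2C \<Longrightarrow> p \<in> U3 \<Longrightarrow> mobius A p \<in> U3"
  using frame_at_point[of p] frame_act_in_frames by (fastforce simp: frame_act_def frame_iff)

lemma mobius_mult:
  "A \<in> SL2C \<Longrightarrow> B \<in> SL2C \<Longrightarrow> p \<in> U3 \<Longrightarrow> mobius (A ** B) p = mobius A (mobius B p)"
  using frame_at_point[of p] frame_act_mult[of A B] by (fastforce simp: frame_act_def)

lemma mobius_one: "p \<in> U3 \<Longrightarrow> mobius (mat 1) p = p"
  using frame_at_point[of p] frame_act_one by (fastforce simp: frame_act_def)

lemma mobius_inverse: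
  assumes "A \<in> SL2C" "p \<in> U3"
  shows "mobius (matrix_inv A) (mobius A p) = p" "mobius A (mobius (matrix_inv A) p) = p"
  using assms by (metis SL2C_inverse(1,2,3) mobius_mult mobius_one)+

lemma mobius_mult_image:
  "A \<in> SL2C \<Longrightarrow> B \<in> SL2C \<Longrightarrow> H \<subseteq> U3 \<Longrightarrow> mobius (A ** B) ` H = mobius A ` mobius B ` H"
  unfolding image_image by (rule image_cong) (auto simp: mobius_mult)

lemma mobius_one_image: "H \<subseteq> U3 \<Longrightarrow> mobius (mat 1) ` H = H"
  by (force simp: mobius_one)

lemma mobius_inverse_image:
  "A \<in> SL2C \<Longrightarrow> H \<subseteq> U3 \<Longrightarrow> mobius (matrix_inv A) ` mobius A ` H = H"
  by (force simp: image_image mobius_inverse)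

text \<open>By linearity it suffices to consider a unit vector, which is the first vector of a frame.\<close>

lemma mobius_deriv_mult:
  assumes "A \<in> SL2C" "B \<in> SL2C" "p \<in> U3"
  shows "mobius_deriv (A ** B) p x = mobius_deriv A (mobius B p) (mobius_deriv B p x)"
proof -
  obtain c u where x: "x = c *\<^sub>R u" and u: "hyp_inner p u u = 1"
    using scaled_unit_vector[OF assms(3)] by metis
  obtain v where "(p, u, v, hyp_cross p u v) \<in> frames"
    using unit_vector_in_frame[OF assms(3) u] .
  from frame_act_mult[OF assms(1,2) this]
  have "mobius_deriv (A ** B) p u = mobius_deriv A (mobius B p) (mobius_deriv B p u)"
    by (simp add: frame_act_def)
  with assms show ?thesis
    by (simp add: x linear_scale linear_mobius_deriv SL2C_mult mobius_in_U3)
qed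

lemma mobius_deriv_one: "mobius_deriv (mat 1) p x = x"
  by (rule mobius_deriv_upper_triangular) (simp_all add: mat1_2)

lemma mobius_deriv_inverse:
  assumes "A \<in> SL2C" "p \<in> U3"
  shows "mobius_deriv (matrix_inv A) (mobius A p) (mobius_deriv A p x) = x"
    "mobius_deriv A (mobius (matrix_inv A) p) (mobius_deriv (matrix_inv A) p x) = x"
proof -
  note mult = mobius_deriv_mult[OF SL2C_inverse(3) assms(1,2), OF assms(1)]
    mobius_deriv_mult[OF assms(1) SL2C_inverse(3) assms(2), OF assms(1)]
  show "mobius_deriv (matrix_inv A) (mobius A p) (mobius_deriv A p x) = x"
    unfolding mult(1)[symmetric] SL2C_inverse(2)[OF assms(1)] by (rule mobius_deriv_one)
  show "mobius_deriv A (mobius (matrix_inv A) p) (mobius_deriv (matrix_inv A) p x) = x"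
    unfolding mult(2)[symmetric] SL2C_inverse(1)[OF assms(1)] by (rule mobius_deriv_one)
qed

text \<open>Unit vectors go to unit vectors because they belong to frames; the rest is polarisation.\<close>

lemma mobius_deriv_isometry:
  assumes "A \<in> SL2C" "p \<in> U3"
  shows "hyp_inner (mobius A p) (mobius_deriv A p x) (mobius_deriv A p y) = hyp_inner p x y"
proof -
  note lin = linear_mobius_deriv[OF assms]
  have norm: "hyp_inner (mobius A p) (mobius_deriv A p x) (mobius_deriv A p x) = hyp_inner p x x" for x
  proof -
    obtain c u where x: "x = c *\<^sub>R u" and u: "hyp_inner p u u = 1"
      using scaled_unit_vector[OF assms(2)] by metis
    obtain v where "(p, u, v, hyp_cross p u v) \<in> frames"
      using unit_vector_in_frame[OF assms(2) u] .
    from frame_act_in_frames[OF assms(1) this]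
    have "hyp_inner (mobius A p) (mobius_deriv A p u) (mobius_deriv A p u) = 1"
      by (simp add: frame_act_def frame_iff)
    with u show ?thesis
      by (simp add: x linear_scale[OF lin] hyp_inner_simps)
  qed
  show ?thesis
    using norm[of "x + y"] norm[of x] norm[of y] hyp_inner_commute[of p x y]
      hyp_inner_commute[of "mobius A p" "mobius_deriv A p x" "mobius_deriv A p y"]
    unfolding linear_add[OF lin] hyp_inner_simps by linarith
qed

text \<open>Here preservation of the orientation enters: the third vector of a frame is the cross product of
the other two.\<close>

lemma mobius_deriv_hyp_cross:
  assumes "A \<in> SL2C" "p \<in> U3" and u: "hyp_inner p u u = 1"
  shows "mobius_deriv A p (hyp_cross p u x) =
    hyp_cross (mobius A p) (mobius_deriv A p u) (mobius_deriv A p x)"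
proof -
  note lin = linear_mobius_deriv[OF assms(1,2)]
  \<comment> \<open>Split off the component of \<open>x\<close> along \<open>u\<close>, which the cross product kills; \<open>u\<close> and the
    normalised rest span a frame.\<close>
  define y where "y = x - hyp_inner p x u *\<^sub>R u"
  have x: "x = y + hyp_inner p x u *\<^sub>R u" by (simp add: y_def)
  have orth: "hyp_inner p u y = 0" by (simp add: y_def hyp_inner_simps u hyp_inner_commute)
  have "mobius_deriv A p (hyp_cross p u y) =
      hyp_cross (mobius A p) (mobius_deriv A p u) (mobius_deriv A p y)"
  proof (cases "y = 0")
    case True
    then show ?thesis by (simp add: hyp_cross_def linear_0[OF lin])
  next
    case False
    define s where "s = sqrt (hyp_inner p y y)"
    have s: "s > 0" "s * s = hyp_inner p y y" using hyp_inner_pos[OF assms(2) False] by (auto simp: s_def)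
    define w where "w = (1 / s) *\<^sub>R y"
    have y: "y = s *\<^sub>R w" using s by (simp add: w_def)
    have "(p, u, w, hyp_cross p u w) \<in> frames"
      using assms orth s by (simp add: frame_iff w_def hyp_inner_simps s(2)[symmetric])
    from frame_act_in_frames[OF assms(1) this] show ?thesis
      by (simp add: frame_act_def frame_iff y linear_scale[OF lin] hyp_cross_simps)
  qed
  then show ?thesis
    by (subst (1 2) x)
      (simp add: hyp_cross_simps linear_add[OF lin] linear_scale[OF lin])
qed

lemma mobius_deriv_rotate_vec:
  assumes "A \<in> SL2C" "p \<in> U3" "hyp_inner p u u = 1"
  shows "mobius_deriv A p (rotate_vec p u \<theta> x) =
    rotate_vec (mobius A p) (mobius_deriv A p u) \<theta> (mobius_deriv A p x)"
  using assms
  by (simp add: rotate_vec_def linear_add[OF linear_mobius_deriv] linear_scale[OF linear_mobius_deriv]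
      mobius_deriv_hyp_cross mobius_deriv_isometry)

lemma frame_act_rotate_frame:
  assumes "A \<in> SL2C" "f \<in> frames" "hyp_inner (fst f) u u = 1"
  shows "frame_act A (rotate_frame u \<theta> f) =
    rotate_frame (mobius_deriv A (fst f) u) \<theta> (frame_act A f)"
proof (cases f)
  case (fields p e1 e2 e3)
  with assms show ?thesis
    by (simp add: rotate_frame_def frame_act_def frame_iff mobius_deriv_rotate_vec)
qed

text \<open>The group element carries the lifted path of rotated frames to a lifted path of rotated frames.\<close>

lemma spin_rotation_act:
  assumes A: "A \<in> SL2C" and e: "e \<in> E" and u: "hyp_inner (fst (pr e)) u u = 1"
    and rot: "spin_rotation E pr u \<theta> e e'"
  shows "spin_rotation E pr (mobius_deriv A (fst (pr e)) u) \<theta> (act A e) (act A e')"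
proof -
  obtain \<gamma> where \<gamma>: "path \<gamma>" "path_image \<gamma> \<subseteq> E" "pathstart \<gamma> = e" "pathfinish \<gamma> = e'"
    "\<forall>s\<in>{0..1}. pr (\<gamma> s) = rotate_frame u (s * \<theta>) (pr e)"
    using rot by (auto simp: spin_rotation_def)
  have mem: "\<gamma> s \<in> E" if "s \<in> {0..1}" for s
    using \<gamma>(2) that by (auto simp: path_image_def)
  have "path (\<lambda>s. act A (\<gamma> s))"
    using \<gamma>(1) mem A unfolding path_def by (intro continuous_on_act) auto
  moreover have "pr (act A (\<gamma> s)) =
      rotate_frame (mobius_deriv A (fst (pr e)) u) (s * \<theta>) (pr (act A e))"
    if "s \<in> {0..1}" for s
    using \<gamma>(5) that A e u mem[OF that] by (simp add: pr_act frame_act_rotate_frame pr_in_frames)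
  ultimately show ?thesis
    unfolding spin_rotation_def using \<gamma>(3,4) mem A
    by (intro exI[of _ "\<lambda>s. act A (\<gamma> s)"])
      (auto simp: path_image_def pathstart_def pathfinish_def act_in_E)
qed

text \<open>Both end points are reached by lifts of the same path of frames from the same spin frame.\<close>

lemma spin_rotation_unique:
  assumes "spin_rotation E pr u \<theta> e e1" "spin_rotation E pr u \<theta> e e2"
  shows "e1 = e2"
proof -
  obtain \<gamma> where \<gamma>: "path \<gamma>" "path_image \<gamma> \<subseteq> E" "pathstart \<gamma> = e" "pathfinish \<gamma> = e1"
    "\<forall>s\<in>{0..1}. pr (\<gamma> s) = rotate_frame u (s * \<theta>) (pr e)"
    using assms(1) by (auto simp: spin_rotation_def)
  obtain \<delta> where \<delta>: "path \<delta>" "path_image \<delta> \<subseteq> E" "pathstart \<delta> = e" "pathfinish \<delta> = e2"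
    "\<forall>s\<in>{0..1}. pr (\<delta> s) = rotate_frame u (s * \<theta>) (pr e)"
    using assms(2) by (auto simp: spin_rotation_def)
  have "\<gamma> 1 = \<delta> 1"
  proof (rule covering_lift_unique[OF covering, of "{0..1}" \<gamma> \<delta> 0 1])
    show "pr (\<gamma> s) = pr (\<delta> s)" if "s \<in> {0..1}" for s
      using \<gamma>(5) \<delta>(5) that by metis
  qed (use \<gamma>(1-3) \<delta>(1-3) in \<open>auto simp: path_def path_image_def pathstart_def\<close>)
  then show ?thesis using \<gamma>(4) \<delta>(4) by (simp add: pathfinish_def)
qed

section \<open>Equivariance of horospheres and their normals\<close>

lemma horofunction_mobius:
  assumes "A \<in> SL2C" "p \<in> U3" "\<kappa> \<noteq> 0"
  shows "horofunction (A *v \<kappa>) (mobius A p) = horofunction \<kappa> p"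
proof -
  \<comment> \<open>If \<open>B\<close> sends the first basis vector to \<open>\<kappa>\<close>, then \<open>A ** B\<close> sends it to \<open>A *v \<kappa>\<close>, and the two
    inverse heights are computed at the same point.\<close>
  define B where "B = spinor_matrix \<kappa>"
  have B: "B \<in> SL2C" "column 1 B = \<kappa>"
    using assms(3) by (simp_all add: B_def spinor_matrix_in_SL2C column_spinor_matrix)
  have "horofunction (A *v \<kappa>) (mobius A p) = 1 / (mobius (matrix_inv (A ** B)) (mobius A p) $ 3)"
    using horofunction_eq_inverse_height[of "A ** B"] B assms(1) by (simp add: SL2C_mult column_mult)
  also have "mobius (matrix_inv (A ** B)) (mobius A p) = mobius (matrix_inv B) p"
    using assms B by (simp add: matrix_inv_SL2C_mult mobius_mult SL2C_inverse(3) mobius_in_U3 mobius_inverse)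
  also have "1 / (\<dots> $ 3) = horofunction \<kappa> p"
    using horofunction_eq_inverse_height[OF B(1)] B by simp
  finally show ?thesis .
qed

lemma mobius_image_horosphere:
  assumes "A \<in> SL2C" "\<kappa> \<noteq> 0"
  shows "mobius A ` horosphere (spinor_centre \<kappa>) (spinor_radius \<kappa>) =
    horosphere (spinor_centre (A *v \<kappa>)) (spinor_radius (A *v \<kappa>))"
proof -
  have "q \<in> mobius A ` {p \<in> U3. horofunction \<kappa> p = 1}"
    if "q \<in> U3" "horofunction (A *v \<kappa>) q = 1" for q
  proof
    show "q = mobius A (mobius (matrix_inv A) q)" using assms that by (simp add: mobius_inverse)
    show "mobius (matrix_inv A) q \<in> {p \<in> U3. horofunction \<kappa> p = 1}"
      using horofunction_mobius[OF assms(1) mobius_in_U3[OF SL2C_inverse(3)] assms(2), OF assms(1) that(1)]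
        assms that by (simp add: mobius_inverse mobius_in_U3 SL2C_inverse(3))
  qed
  then show ?thesis
    using assms by (auto simp: horosphere_eq_level_set SL2C_mult_nonzero mobius_in_U3 horofunction_mobius)
qed

text \<open>Differentiating the invariance of the horofunction shows that an isometry carries its gradient
on one horosphere to its gradient on the image.\<close>

lemma mobius_deriv_N_out:
  assumes A: "A \<in> SL2C" and \<kappa>: "\<kappa> \<noteq> 0" and p: "p \<in> horosphere (spinor_centre \<kappa>) (spinor_radius \<kappa>)"
  shows "mobius_deriv A p (N_out (spinor_centre \<kappa>) (spinor_radius \<kappa>) p) =
    N_out (spinor_centre (A *v \<kappa>)) (spinor_radius (A *v \<kappa>)) (mobius A p)"
    (is "mobius_deriv A p ?N = ?N'")
proof -
  have pU: "p \<in> U3" "horofunction \<kappa> p = 1"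
    using p \<kappa> by (auto simp: horosphere_eq_level_set)
  have "(horofunction (A *v \<kappa>) has_derivative (\<lambda>u. - hyp_inner (mobius A p) u ?N')) (at (mobius A p))"
    using A \<kappa> pU by (intro horofunction_gradient) (simp_all add: SL2C_mult_nonzero mobius_in_U3 horofunction_mobius)
  from has_derivative_compose[OF mobius_deriv_has_derivative[OF A pU(1)] this]
  have "(horofunction \<kappa> has_derivative (\<lambda>u. - hyp_inner (mobius A p) (mobius_deriv A p u) ?N')) (at p)"
    by (rule has_derivative_transform_within_open[OF _ open_U3 pU(1)])
      (use A \<kappa> in \<open>simp add: horofunction_mobius\<close>)
  then have "(\<lambda>u. - hyp_inner (mobius A p) (mobius_deriv A p u) ?N') = (\<lambda>u. - hyp_inner p u ?N)"
    using has_derivative_unique horofunction_gradient[OF \<kappa> pU] by blast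
  then have "hyp_inner (mobius A p) (mobius_deriv A p u) (?N' - mobius_deriv A p ?N) = 0" for u
    using mobius_deriv_isometry[OF A pU(1), of u ?N] by (simp add: hyp_inner_simps fun_eq_iff)
  \<comment> \<open>The differential is onto, so \<open>u\<close> can be chosen with image \<open>?N' - mobius_deriv A p ?N\<close>.\<close>
  from this[of "mobius_deriv (matrix_inv A) (mobius A p) (?N' - mobius_deriv A p ?N)"]
  have "hyp_inner (mobius A p) (?N' - mobius_deriv A p ?N) (?N' - mobius_deriv A p ?N) = 0"
    using mobius_deriv_inverse(2)[OF A mobius_in_U3[OF A pU(1)]] mobius_inverse(1)[OF A pU(1)] by simp
  then show ?thesis
    using hyp_inner_eq_zero mobius_in_U3[OF A pU(1)] by fastforce
qed

section \<open>The action on spin-decorated horospheres\<close>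

definition transport_vector_field ::
    "complex^2^2 \<Rightarrow> (real^3) set \<Rightarrow> (real^3 \<Rightarrow> real^3) \<Rightarrow> real^3 \<Rightarrow> real^3" where
  "transport_vector_field A H v = restrict
     (\<lambda>q. mobius_deriv A (mobius (matrix_inv A) q) (v (mobius (matrix_inv A) q))) (mobius A ` H)"

lemma transport_vector_field_apply:
  "A \<in> SL2C \<Longrightarrow> H \<subseteq> U3 \<Longrightarrow> p \<in> H \<Longrightarrow>
    transport_vector_field A H v (mobius A p) = mobius_deriv A p (v p)"
  by (auto simp: transport_vector_field_def mobius_inverse)

lemma transport_field_apply:
  "A \<in> SL2C \<Longrightarrow> H \<subseteq> U3 \<Longrightarrow> p \<in> H \<Longrightarrow> transport_field act A H W (mobius A p) = act A (W p)"
  by (auto simp: transport_field_def mobius_inverse)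

text \<open>Parabolic isometries preserving the image horosphere are conjugate to those preserving the
original one.\<close>

lemma decoration_transport:
  assumes A: "A \<in> SL2C" and \<kappa>: "\<kappa> \<noteq> 0" and v: "decoration (spinor_centre \<kappa>) (spinor_radius \<kappa>) v"
  shows "decoration (spinor_centre (A *v \<kappa>)) (spinor_radius (A *v \<kappa>))
    (transport_vector_field A (horosphere (spinor_centre \<kappa>) (spinor_radius \<kappa>)) v)"
    (is "decoration ?\<xi>' ?r' ?v'")
proof -
  define H where "H = horosphere (spinor_centre \<kappa>) (spinor_radius \<kappa>)"
  have HU: "H \<subseteq> U3"
    unfolding H_def by (rule horosphere_subset_U3[OF spinor_radius_pos[OF \<kappa>]])
  have H': "horosphere ?\<xi>' ?r' = mobius A ` H"
    unfolding H_def by (rule mobius_image_horosphere[OF A \<kappa>, symmetric])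
  have v': "?v' (mobius A p) = mobius_deriv A p (v p)" if "p \<in> H" for p
    using transport_vector_field_apply[OF A HU that] by (simp add: H_def)
  have "?v' \<in> extensional (mobius A ` H)"
    by (simp add: transport_vector_field_def H_def)
  moreover have "hyp_inner (mobius A p) (?v' (mobius A p)) (?v' (mobius A p)) = 1 \<and>
      hyp_inner (mobius A p) (?v' (mobius A p)) (N_out ?\<xi>' ?r' (mobius A p)) = 0" if p: "p \<in> H" for p
  proof -
    have "N_out ?\<xi>' ?r' (mobius A p) = mobius_deriv A p (N_out (spinor_centre \<kappa>) (spinor_radius \<kappa>) p)"
      using mobius_deriv_N_out[OF A \<kappa>] p by (simp add: H_def)
    then show ?thesis
      using v p A HU by (auto simp: v' mobius_deriv_isometry subset_iff decoration_def H_def)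
  qed
  moreover have "mobius_deriv B (mobius A p) (?v' (mobius A p)) = ?v' (mobius B (mobius A p))"
    if B: "parabolic B" "mobius B ` mobius A ` H = mobius A ` H" and p: "p \<in> H" for B p
  proof -
    \<comment> \<open>The conjugate \<open>C\<close> is a parabolic isometry preserving the original horosphere, and \<open>A C = B A\<close>.\<close>
    define C where "C = matrix_inv A ** B ** A"
    have BS: "B \<in> SL2C" using B(1) by (simp add: parabolic_def)
    have CS: "C \<in> SL2C" using A BS by (simp add: C_def SL2C_mult SL2C_inverse(3))
    have AC: "A ** C = B ** A"
      by (simp add: C_def matrix_mul_assoc SL2C_inverse(1)[OF A])
    have "mobius C ` H = mobius (matrix_inv A) ` mobius B ` mobius A ` H"
    proof -
      have "mobius A ` H \<subseteq> U3" using A HU by (auto intro: mobius_in_U3)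
      then show ?thesis
        using A BS HU by (simp add: C_def mobius_mult_image SL2C_mult SL2C_inverse(3))
    qed
    then have CH: "mobius C ` H = H"
      using B(2) mobius_inverse_image[OF A HU] by simp
    have pU: "p \<in> U3" using p HU by blast
    have Cp: "mobius C p \<in> H" using CH p by blast
    have "mobius_deriv C p (v p) = v (mobius C p)"
      using v CH p parabolic_conjugate[OF A B(1)] by (auto simp: decoration_def H_def C_def)
    then have "mobius_deriv (A ** C) p (v p) = mobius_deriv A (mobius C p) (v (mobius C p))"
      by (simp add: mobius_deriv_mult A CS pU)
    also have "\<dots> = ?v' (mobius (A ** C) p)"
      by (simp add: v' Cp mobius_mult A CS pU)
    finally show ?thesis
      by (simp add: AC mobius_deriv_mult mobius_mult A BS pU v' p)
  qed
  ultimately show ?thesis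
    unfolding decoration_def H' by blast
qed

lemma continuous_lift_transport:
  assumes A: "A \<in> SL2C" and H: "H \<subseteq> U3" and W: "continuous_lift E pr H F W"
    and F': "\<And>p. p \<in> H \<Longrightarrow> F' (mobius A p) = frame_act A (F p)"
  shows "continuous_lift E pr (mobius A ` H) F' (transport_field act A H W)"
proof -
  have WE: "W p \<in> E" "pr (W p) = F p" if "p \<in> H" for p
    using W that by (auto simp: continuous_lift_def)
  have HU: "mobius A ` H \<subseteq> U3" using A H by (auto intro: mobius_in_U3)
  have preimage_in_H: "mobius (matrix_inv A) ` mobius A ` H \<subseteq> H"
    using mobius_inverse_image[OF A H] by simp
  have "continuous_on (mobius A ` H) (\<lambda>q. act A (W (mobius (matrix_inv A) q)))"
  proof (intro continuous_on_act continuous_on_const)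
    show "continuous_on (mobius A ` H) (\<lambda>q. W (mobius (matrix_inv A) q))"
    proof (rule continuous_on_compose2[OF _ _ preimage_in_H])
      show "continuous_on H W" using W by (simp add: continuous_lift_def)
      show "continuous_on (mobius A ` H) (mobius (matrix_inv A))"
        using continuous_on_mobius[OF SL2C_inverse(3)[OF A]] HU continuous_on_subset by blast
    qed
  qed (use A preimage_in_H WE in auto)
  then have "continuous_on (mobius A ` H) (transport_field act A H W)"
    by (rule continuous_on_eq) (simp add: transport_field_def)
  then show ?thesis
    using A H WE F'
    by (auto simp: continuous_lift_def transport_field_apply act_in_E pr_act) (simp add: transport_field_def)
qed

text \<open>Every ingredient of a spin decoration is equivariant: centre and radius through a spinor, the
normals, the frames built from them, and the rotations.\<close>

lemma HorS_act_closed: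
  assumes A: "A \<in> SL2C" and h: "h \<in> HorS E pr"
  shows "HorS_act act A h \<in> HorS E pr"
proof -
  obtain H Win Wout \<xi> r v where h_eq: "h = (H, Win, Wout)" and r: "r > 0"
    and H0: "H = horosphere \<xi> r" and v0: "decoration \<xi> r v"
    and lifts0: "continuous_lift E pr H (inward_frame \<xi> r v) Win"
      "continuous_lift E pr H (outward_frame \<xi> r v) Wout"
    and assoc: "associated_spin_decorations E pr H v Win Wout"
    using h by (auto simp: HorS_def)
  obtain \<kappa> where \<kappa>: "\<kappa> \<noteq> 0" and \<xi>: "spinor_centre \<kappa> = \<xi>" and r_eq: "spinor_radius \<kappa> = r"
    using horosphere_spinor_exists[OF r] .
  define \<xi>' r' v' where "\<xi>' = spinor_centre (A *v \<kappa>)" and "r' = spinor_radius (A *v \<kappa>)"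
    and "v' = transport_vector_field A H v"
  have HU: "H \<subseteq> U3" unfolding H0 by (rule horosphere_subset_U3[OF r])
  have H': "mobius A ` H = horosphere \<xi>' r'"
    using mobius_image_horosphere[OF A \<kappa>] by (simp add: H0 \<xi> r_eq \<xi>'_def r'_def)
  have r': "r' > 0"
    unfolding r'_def by (rule spinor_radius_pos[OF SL2C_mult_nonzero[OF A \<kappa>]])
  have dec': "decoration \<xi>' r' v'"
    using decoration_transport[OF A \<kappa>] v0 by (simp add: \<xi> r_eq \<xi>'_def r'_def v'_def H0)
  have v': "v' (mobius A p) = mobius_deriv A p (v p)" if "p \<in> H" for p
    unfolding v'_def by (rule transport_vector_field_apply[OF A HU that])
  have N: "N_out \<xi>' r' (mobius A p) = mobius_deriv A p (N_out \<xi> r p)" if "p \<in> H" for p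
    using mobius_deriv_N_out[OF A \<kappa>] that by (simp add: H0 \<xi> r_eq \<xi>'_def r'_def)
  have unit: "hyp_inner p (v p) (v p) = 1" if "p \<in> H" for p
    using v0 that by (simp add: decoration_def H0)
  have Win: "Win p \<in> E" "pr (Win p) = inward_frame \<xi> r v p"
    and Wout: "Wout p \<in> E" "pr (Wout p) = outward_frame \<xi> r v p" if "p \<in> H" for p
    using lifts0 that by (auto simp: continuous_lift_def)
  have frame: "mobius_deriv A p (hyp_cross p n (v p)) = hyp_cross (mobius A p) (mobius_deriv A p n) (mobius_deriv A p (v p))"
    if "p \<in> H" "(p, n, v p, hyp_cross p n (v p)) \<in> frames" for p n
    using that by (simp add: frame_iff mobius_deriv_hyp_cross A)
  \<comment> \<open>The frame conditions on \<open>v\<close> and the normals come for free from the lifts: the projection of a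
    spin frame is a frame.\<close>
  have in_frames: "(p, N_in \<xi> r p, v p, hyp_cross p (N_in \<xi> r p) (v p)) \<in> frames"
    "(p, N_out \<xi> r p, v p, hyp_cross p (N_out \<xi> r p) (v p)) \<in> frames" if "p \<in> H" for p
    using pr_in_frames Win[OF that] Wout[OF that] by (metis inward_frame_def, metis outward_frame_def)
  have inward: "inward_frame \<xi>' r' v' (mobius A p) = frame_act A (inward_frame \<xi> r v p)"
    and outward: "outward_frame \<xi>' r' v' (mobius A p) = frame_act A (outward_frame \<xi> r v p)" if "p \<in> H" for p
    using that HU frame[OF that in_frames(1)[OF that]] frame[OF that in_frames(2)[OF that]]
    by (auto simp: inward_frame_def outward_frame_def frame_act_def v' N N_in_def
        linear_neg[OF linear_mobius_deriv] A)
  have "continuous_lift E pr (mobius A ` H) (inward_frame \<xi>' r' v') (transport_field act A H Win)"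
    by (rule continuous_lift_transport[OF A HU lifts0(1) inward])
  moreover have "continuous_lift E pr (mobius A ` H) (outward_frame \<xi>' r' v') (transport_field act A H Wout)"
    by (rule continuous_lift_transport[OF A HU lifts0(2) outward])
  moreover have "associated_spin_decorations E pr (mobius A ` H) v'
      (transport_field act A H Win) (transport_field act A H Wout)"
  proof -
    have "spin_rotation E pr (v' (mobius A p)) (- pi) (act A (Win p)) (act A (Wout p)) \<and>
      spin_rotation E pr (v' (mobius A p)) pi (act A (Wout p)) (act A (Win p))" if p: "p \<in> H" for p
    proof -
      have base: "fst (pr (Win p)) = p" "fst (pr (Wout p)) = p"
        using Win[OF p] Wout[OF p] by (auto simp: inward_frame_def outward_frame_def)
      show ?thesis
        using spin_rotation_act[OF A Win(1)[OF p], of "v p" "- pi" "Wout p"]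
          spin_rotation_act[OF A Wout(1)[OF p], of "v p" pi "Win p"] assoc p unit[OF p]
        by (simp add: base v' associated_spin_decorations_def)
    qed
    then show ?thesis
      using transport_field_apply[OF A HU] by (auto simp: associated_spin_decorations_def)
  qed
  ultimately show ?thesis
    unfolding h_eq HorS_act_def HorS_def using r' dec' H' by auto
qed

lemma HorS_fields:
  assumes "(H, Win, Wout) \<in> HorS E pr"
  shows "H \<subseteq> U3" "p \<in> H \<Longrightarrow> Win p \<in> E" "p \<in> H \<Longrightarrow> Wout p \<in> E"
    "Win \<in> extensional H" "Wout \<in> extensional H"
  using assms horosphere_subset_U3 by (auto simp: HorS_def continuous_lift_def)

lemma transport_field_mult:
  assumes "A \<in> SL2C" "B \<in> SL2C" "H \<subseteq> U3" "\<And>p. p \<in> H \<Longrightarrow> W p \<in> E"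
  shows "transport_field act (A ** B) H W =
    transport_field act A (mobius B ` H) (transport_field act B H W)"
proof (rule extensionalityI)
  have BH: "mobius B ` H \<subseteq> U3" using assms by (auto intro: mobius_in_U3)
  fix q assume "q \<in> mobius (A ** B) ` H"
  then obtain p where p: "p \<in> H" "q = mobius (A ** B) p" by blast
  have "mobius (A ** B) p = mobius A (mobius B p)" using assms p by (auto intro: mobius_mult)
  then show "transport_field act (A ** B) H W q =
      transport_field act A (mobius B ` H) (transport_field act B H W) q"
    using p assms BH transport_field_apply[of "A ** B" H p W]
    by (simp add: transport_field_apply act_mult SL2C_mult)
qed (auto simp: transport_field_def mobius_mult_image[OF assms(1-3)])

lemma HorS_act_mult:
  assumes "A \<in> SL2C" "B \<in> SL2C" "h \<in> HorS E pr"
  shows "HorS_act act (A ** B) h = HorS_act act A (HorS_act act B h)"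
proof (cases h)
  case (fields H Win Wout)
  note HorS_fields[OF assms(3)[unfolded fields]]
  then show ?thesis
    using assms by (simp add: fields HorS_act_def transport_field_mult mobius_mult_image)
qed

lemma transport_field_one:
  assumes "H \<subseteq> U3" "\<And>p. p \<in> H \<Longrightarrow> W p \<in> E" "W \<in> extensional H"
  shows "transport_field act (mat 1) H W = W"
proof (rule extensionalityI[where A = H])
  fix p assume p: "p \<in> H"
  then show "transport_field act (mat 1) H W p = W p"
    using transport_field_apply[OF SL2C_one assms(1) p] assms by (auto simp: mobius_one act_one)
qed (use assms in \<open>auto simp: transport_field_def mobius_one_image\<close>)

lemma HorS_act_one:
  assumes "h \<in> HorS E pr"
  shows "HorS_act act (mat 1) h = h"
proof (cases h)
  case (fields H Win Wout)
  note HorS_fields[OF assms[unfolded fields]]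
  then show ?thesis
    by (simp add: fields HorS_act_def transport_field_one mobius_one_image)
qed

end

section \<open>Decorations of the plane at height 1\<close>

definition base_plane :: "(real^3) set" where
  "base_plane = horosphere Infinite_Point 1"

lemma base_plane_iff: "p \<in> base_plane \<longleftrightarrow> p$3 = 1"
  by (simp add: base_plane_def)

lemma base_plane_subset_U3: "base_plane \<subseteq> U3"
  by (auto simp: base_plane_iff U3_def)

lemma base_point_in_base_plane: "base_point \<in> base_plane"
  by (simp add: base_plane_iff base_point_def)

lemma connected_base_plane: "connected base_plane"
  by (rule convex_connected)
    (auto simp: convex_def base_plane_iff simp flip: distrib_right)

text \<open>For a point of the plane at height 1, this is the translation that takes the base point to it.\<close>

definition base_translation :: "real^3 \<Rightarrow> complex^2^2" where
  "base_translation p = translation (Complex (p$1) (p$2))"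

lemma base_translation_in_SL2C: "base_translation p \<in> SL2C"
  by (simp add: base_translation_def translation_in_SL2C)

lemma mobius_base_translation: "p \<in> base_plane \<Longrightarrow> mobius (base_translation p) base_point = p"
  by (simp add: base_translation_def mobius_translation base_point_def base_plane_iff vec_eq_iff forall_3)

lemma base_translation_base_point: "base_translation base_point = mat 1"
  by (simp add: base_translation_def translation_def base_point_def mat2_eq_iff mat1_2 complex_eq_iff)

lemma mobius_translation_base_plane: "mobius (translation b) ` base_plane = base_plane"
proof -
  have "p \<in> mobius (translation b) ` base_plane" if "p \<in> base_plane" for p
    by (rule image_eqI[of _ _ "p - vector [Re b, Im b, 0]"])
      (use that in \<open>auto simp: mobius_translation base_plane_iff\<close>)
  then show ?thesis by (auto simp: mobius_translation base_plane_iff)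
qed

text \<open>Up to sign, a parabolic element preserving the plane is a translation. Hence constant fields are
invariant under all of them.\<close>

lemma parabolic_base_plane:
  assumes "parabolic A" "mobius A ` base_plane = base_plane"
  shows "mobius_deriv A p x = x"
proof -
  define a c d where "a = A$1$1" and "c = A$2$1" and "d = A$2$2"
  have A: "A \<in> SL2C" "(a + d)\<^sup>2 = 4"
    using assms(1) by (auto simp: parabolic_def trace_def sum_2 a_def d_def)
  \<comment> \<open>The point above \<open>z\<close> at height 1 is mapped to height \<open>1 / (|c z + d|\<^sup>2 + |c|\<^sup>2)\<close>.\<close>
  have height: "(cmod (c * z + d))\<^sup>2 + (cmod c)\<^sup>2 = 1" for z
  proof -
    have "mobius A (vector [Re z, Im z, 1]) \<in> base_plane"
      using assms(2) by (auto simp: base_plane_iff)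
    then show ?thesis
      by (simp add: base_plane_iff mobius_height c_def d_def divide_eq_eq split: if_splits)
  qed
  \<comment> \<open>The parallelogram law turns the values at \<open>0\<close>, \<open>1\<close> and \<open>-1\<close> into \<open>c = 0\<close>.\<close>
  have "(cmod (c + d))\<^sup>2 + (cmod (- c + d))\<^sup>2 = 2 * (cmod c)\<^sup>2 + 2 * (cmod d)\<^sup>2"
    unfolding cmod_power2 by (simp add: power2_eq_square algebra_simps)
  then have "(cmod c)\<^sup>2 = 0"
    using height[of 0] height[of 1] height[of "- 1"]
    unfolding mult_minus1_right mult_1_right mult_zero_right add_0_left by linarith
  then have "c = 0" by simp
  \<comment> \<open>Now \<open>a d = 1\<close>, and the trace condition says \<open>(a + d)\<^sup>2 = 4 a d\<close>.\<close>
  moreover have ad: "a * d = 1"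
    using A(1) \<open>c = 0\<close> by (simp add: SL2C_iff a_def c_def d_def)
  then have "(a - d)\<^sup>2 = 0"
    using A(2) by (simp add: power2_eq_square algebra_simps)
  then have "a = d" by simp
  then have d2: "d\<^sup>2 = 1" using ad by (simp add: power2_eq_square)
  then have "d = 1 \<or> d = - 1" by (simp add: power2_eq_1_iff)
  ultimately show ?thesis
    using \<open>a = d\<close> by (intro mobius_deriv_upper_triangular) (auto simp: a_def c_def d_def)
qed

definition base_field :: "real^3 \<Rightarrow> real^3" where
  "base_field = restrict (\<lambda>p. vector [1, 0, 0]) base_plane"

lemma base_field_decoration: "decoration Infinite_Point 1 base_field"
  unfolding decoration_def base_plane_def[symmetric]
  by (auto simp: base_field_def base_plane_iff parabolic_base_plane hyp_inner_def inner_vec_def sum_3)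

text \<open>Conversely, translations are transitive on the plane and act trivially on tangent vectors, so
invariance under them leaves only constant fields.\<close>

lemma decoration_base_plane_constant:
  assumes v: "decoration Infinite_Point 1 v" and p: "p \<in> base_plane"
  shows "v p = v base_point"
proof (cases "Complex (p$1) (p$2) = 0")
  case True
  then have "p = base_point"
    using p by (simp add: base_plane_iff base_point_def vec_eq_iff forall_3 complex_eq_iff)
  then show ?thesis by simp
next
  case False
  have "mobius_deriv (base_translation p) base_point (v base_point)
      = v (mobius (base_translation p) base_point)"
    using v parabolic_translation[OF False] mobius_translation_base_plane base_point_in_base_plane
    unfolding decoration_def base_plane_def[symmetric] base_translation_def by blast
  then show ?thesis
    using mobius_base_translation[OF p]
    by (simp add: base_translation_def mobius_deriv_translation)
qed

section \<open>The base spin-decorated horosphere\<close>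

context spin_frames
begin

definition base_lift :: "'e \<Rightarrow> real^3 \<Rightarrow> 'e" where
  "base_lift e = restrict (\<lambda>p. act (base_translation p) e) base_plane"

text \<open>Translations act as the identity on tangent vectors, so the translated spin frame lies over the
constant frame field.\<close>

lemma base_lift_continuous_lift:
  assumes e: "e \<in> E" and F: "\<And>p. p \<in> base_plane \<Longrightarrow> F p = (p, snd (pr e))"
    and base: "fst (pr e) = base_point"
  shows "continuous_lift E pr base_plane F (base_lift e)"
proof -
  have "continuous_on base_plane base_translation"
    unfolding base_translation_def translation_def Complex_eq
    by (intro continuous_on_mat2 continuous_intros)
  then have "continuous_on base_plane (\<lambda>p. act (base_translation p) e)"
    by (intro continuous_on_act) (auto simp: base_translation_in_SL2C e)
  then have "continuous_on base_plane (base_lift e)"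
    by (rule continuous_on_eq) (simp add: base_lift_def)
  moreover have "pr (act (base_translation p) e) = F p" if "p \<in> base_plane" for p
  proof -
    have "frame_act (base_translation p) (pr e) = (p, snd (pr e))"
      using base mobius_base_translation[OF that]
      by (cases "pr e") (simp add: frame_act_def base_translation_def mobius_deriv_translation)
    then show ?thesis using e that F by (simp add: pr_act base_translation_in_SL2C)
  qed
  ultimately show ?thesis
    using e by (auto simp: continuous_lift_def base_lift_def act_in_E base_translation_in_SL2C)
qed

text \<open>The path $s \mapsto$ \<open>act (rotation (\<phi> + s * \<theta>)) e\<close> lifts the path of
rotated frames, so rotations of this spin frame are given by the one-parameter group.\<close>

lemma spin_rotation_rotation:
  assumes e: "e \<in> E" "pr e = base_frame 0"
  shows "spin_rotation E pr (vector [1, 0, 0]) \<theta> (act (rotation \<phi>) e) (act (rotation (\<phi> + \<theta>)) e)"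
proof -
  have "path (\<lambda>s. act (rotation (\<phi> + s * \<theta>)) e)"
    unfolding path_def
  proof (intro continuous_on_act continuous_on_const)
    show "continuous_on {0..1} (\<lambda>s. rotation (\<phi> + s * \<theta>))"
      unfolding rotation_def by (intro continuous_on_mat2 continuous_intros) auto
  qed (simp_all add: rotation_in_SL2C e)
  moreover have "pr (act (rotation \<alpha>) e) = base_frame \<alpha>" for \<alpha>
    using e by (simp add: pr_act rotation_in_SL2C frame_act_rotation)
  ultimately show ?thesis
    unfolding spin_rotation_def
    by (intro exI[of _ "\<lambda>s. act (rotation (\<phi> + s * \<theta>)) e"])
      (auto simp: path_image_def pathstart_def pathfinish_def act_in_E rotation_in_SL2C e
        rotate_frame_base_frame add.commute)
qed

text \<open>The outward spin frame over the base point is the inward one turned by the angle $-\pi$ about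
the decoration.\<close>

definition base_element :: "'e \<Rightarrow> 'e spin_horosphere" where
  "base_element e = (base_plane, base_lift e, base_lift (act (rotation (- pi)) e))"

lemma inward_frame_base_plane:
  "p \<in> base_plane \<Longrightarrow> inward_frame Infinite_Point 1 base_field p = (p, snd (base_frame 0))"
  by (simp add: inward_frame_def base_field_def base_frame_def N_in_def hyp_cross_def base_plane_iff
      cross3_def vec_eq_iff forall_3)

lemma outward_frame_base_plane:
  "p \<in> base_plane \<Longrightarrow> outward_frame Infinite_Point 1 base_field p = (p, snd (base_frame (- pi)))"
  by (simp add: outward_frame_def base_field_def base_frame_def hyp_cross_def base_plane_iff
      cross3_def vec_eq_iff forall_3)

text \<open>The rotations relating the two spin frames over the base point are transported to the other
points by translations.\<close>

lemma base_element_decorations: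
  assumes e: "e \<in> E" "pr e = base_frame 0"
  shows "continuous_lift E pr base_plane (inward_frame Infinite_Point 1 base_field) (base_lift e)"
    and "continuous_lift E pr base_plane (outward_frame Infinite_Point 1 base_field)
      (base_lift (act (rotation (- pi)) e))"
    and "associated_spin_decorations E pr base_plane base_field (base_lift e)
      (base_lift (act (rotation (- pi)) e))"
proof -
  define e' where "e' = act (rotation (- pi)) e"
  have e': "e' \<in> E" "pr e' = base_frame (- pi)"
    using e by (simp_all add: e'_def act_in_E pr_act rotation_in_SL2C frame_act_rotation)
  show "continuous_lift E pr base_plane (inward_frame Infinite_Point 1 base_field) (base_lift e)"
    by (rule base_lift_continuous_lift) (use e in \<open>simp_all add: inward_frame_base_plane, simp add: base_frame_def\<close>)
  show "continuous_lift E pr base_plane (outward_frame Infinite_Point 1 base_field)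
      (base_lift (act (rotation (- pi)) e))"
    unfolding e'_def[symmetric]
    by (rule base_lift_continuous_lift) (use e' in \<open>simp_all add: outward_frame_base_plane, simp add: base_frame_def\<close>)
  have "rotation 0 = mat 1" by (simp add: rotation_def mat2_eq_iff mat1_2)
  then have rot: "spin_rotation E pr (vector [1, 0, 0]) (- pi) e e'"
    "spin_rotation E pr (vector [1, 0, 0]) pi e' e"
    using spin_rotation_rotation[OF e, of "- pi" 0] spin_rotation_rotation[OF e, of pi "- pi"] e
    by (simp_all add: e'_def act_one)
  have "associated_spin_decorations E pr base_plane base_field (base_lift e) (base_lift e')"
    unfolding associated_spin_decorations_def
  proof (intro ballI)
    fix p assume p: "p \<in> base_plane"
    have base: "fst (pr e) = base_point" "fst (pr e') = base_point"
      using e e' by (simp_all add: base_frame_def)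
    have unit: "hyp_inner base_point (vector [1, 0, 0]) (vector [1, 0, 0]) = 1"
      by (simp add: hyp_inner_def base_point_def inner_vec_def sum_3)
    show "spin_rotation E pr (base_field p) (- pi) (base_lift e p) (base_lift e' p) \<and>
        spin_rotation E pr (base_field p) pi (base_lift e' p) (base_lift e p)"
      using spin_rotation_act[OF base_translation_in_SL2C e(1) _ rot(1), of p]
        spin_rotation_act[OF base_translation_in_SL2C e'(1) _ rot(2), of p] p
      by (simp add: base unit base_field_def base_lift_def base_translation_def mobius_deriv_translation)
  qed
  then show "associated_spin_decorations E pr base_plane base_field (base_lift e)
      (base_lift (act (rotation (- pi)) e))"
    by (simp add: e'_def)
qed

lemma base_element_in_HorS:
  assumes "e \<in> E" "pr e = base_frame 0"
  shows "base_element e \<in> HorS E pr"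
  unfolding base_element_def HorS_def
  using base_element_decorations[OF assms] base_field_decoration
  by (auto simp: base_plane_def intro!: exI[of _ Infinite_Point] exI[of _ "1::real"] exI[of _ base_field])

text \<open>A spin-decorated horosphere is determined by a single inward spin frame. It is enough to see
this for the spin frame at the base point, since the group acts transitively on spin frames.\<close>

lemma base_element_unique:
  assumes e: "e \<in> E" "pr e = base_frame 0"
    and h: "(H, Win, Wout) \<in> HorS E pr" and base: "base_point \<in> H" "Win base_point = e"
  shows "(H, Win, Wout) = base_element e"
proof -
  obtain \<xi> r v where r: "r > 0" and H: "H = horosphere \<xi> r" and v: "decoration \<xi> r v"
    and Win: "continuous_lift E pr H (inward_frame \<xi> r v) Win"
    and Wout: "continuous_lift E pr H (outward_frame \<xi> r v) Wout"
    and assoc: "associated_spin_decorations E pr H v Win Wout"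
    using h by (auto simp: HorS_def)
  have "inward_frame \<xi> r v base_point = base_frame 0"
    using Win base e by (auto simp: continuous_lift_def)
  then have N: "N_in \<xi> r base_point = vector [0, 0, - 1]" and v1: "v base_point = vector [1, 0, 0]"
    by (auto simp: inward_frame_def base_frame_def)
  \<comment> \<open>The first vector of the frame pins down the horosphere, the second one the decoration.\<close>
  have "N_out \<xi> r base_point = N_out Infinite_Point 1 base_point"
    using N by (simp add: N_in_def base_point_def vec_eq_iff forall_3)
  then have "\<xi> = Infinite_Point \<and> r = 1"
    using horosphere_determined_by_normal[of base_point \<xi> r Infinite_Point 1] base H r
      base_point_in_base_plane by (simp add: base_plane_def)
  then have \<xi>: "\<xi> = Infinite_Point" "r = 1" by simp_all
  then have Hb: "H = base_plane" by (simp add: H base_plane_def)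
  have vb: "v p = base_field p" for p
  proof (cases "p \<in> base_plane")
    case True
    then show ?thesis using decoration_base_plane_constant[of v p] v v1 \<xi> by (simp add: base_field_def)
  next
    case False
    then show ?thesis using v \<xi> by (auto simp: decoration_def base_field_def base_plane_def extensional_def)
  qed
  then have vb: "v = base_field" by blast
  note base_spin = base_element_decorations[OF e]
  have "Win p = base_lift e p" if "p \<in> base_plane" for p
  proof (rule covering_lift_unique[OF covering connected_base_plane, of Win "base_lift e" base_point p])
    show "Win base_point = base_lift e base_point"
      using base e by (simp add: base_lift_def base_point_in_base_plane base_translation_base_point act_one)
  qed (use Win base_spin(1) that base_point_in_base_plane in \<open>auto simp: continuous_lift_def \<xi> vb Hb\<close>)
  then have Win_eq: "Win = base_lift e"
    using Win by (intro extensionalityI[of _ base_plane]) (auto simp: continuous_lift_def Hb base_lift_def)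
  have "Wout p = base_lift (act (rotation (- pi)) e) p" if "p \<in> base_plane" for p
    using spin_rotation_unique assoc base_spin(3) that
    unfolding associated_spin_decorations_def Hb vb Win_eq by blast
  then have "Wout = base_lift (act (rotation (- pi)) e)"
    using Wout by (intro extensionalityI[of _ base_plane]) (auto simp: continuous_lift_def Hb base_lift_def)
  then show ?thesis by (simp add: base_element_def Hb Win_eq)
qed

text \<open>Translating by \<open>b\<close> after translating to \<open>p\<close> is the translation to the
image of \<open>p\<close>.\<close>

lemma transport_base_lift:
  assumes "e \<in> E"
  shows "transport_field act (translation b) base_plane (base_lift e) = base_lift e"
proof (rule extensionalityI[where A = base_plane])
  fix q assume "q \<in> base_plane"
  then obtain p where p: "p \<in> base_plane" "q = mobius (translation b) p"
    using mobius_translation_base_plane[of b] by blast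
  have "b + Complex (p$1) (p$2) = Complex (q$1) (q$2)"
    by (simp add: p mobius_translation complex_eq_iff)
  then have "translation b ** base_translation p = base_translation q"
    by (simp add: base_translation_def translation_mult)
  then have "act (translation b) (base_lift e p) = base_lift e q"
    using act_mult[OF translation_in_SL2C[of b] base_translation_in_SL2C[of p] assms] p \<open>q \<in> base_plane\<close>
    by (simp add: base_lift_def)
  then show "transport_field act (translation b) base_plane (base_lift e) q = base_lift e q"
    by (simp add: transport_field_apply[OF translation_in_SL2C base_plane_subset_U3 p(1)] p(2))
qed (auto simp: transport_field_def base_lift_def mobius_translation_base_plane)

text \<open>An element of the stabiliser maps the inward spin frame over some point of the plane to the one
over the base point. A translation does the same, and the action on spin frames is free.\<close>

lemma stabiliser_base_element:
  assumes e: "e \<in> E" "pr e = base_frame 0"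
  shows "{A \<in> SL2C. HorS_act act A (base_element e) = base_element e} = range translation"
proof (intro equalityI subsetI)
  fix A assume "A \<in> {A \<in> SL2C. HorS_act act A (base_element e) = base_element e}"
  then have A: "A \<in> SL2C" and H: "mobius A ` base_plane = base_plane"
    and W: "transport_field act A base_plane (base_lift e) = base_lift e"
    by (auto simp: HorS_act_def base_element_def)
  obtain p where p: "p \<in> base_plane" "mobius A p = base_point"
    using H base_point_in_base_plane by (metis imageE)
  \<comment> \<open>Both sides are the inward spin frame over the base point.\<close>
  have "act A (base_lift e p) = base_lift e base_point"
    using transport_field_apply[OF A base_plane_subset_U3 p(1), of "base_lift e"] W p by simp
  then have "act (A ** base_translation p) e = act (mat 1) e"
    using p e A by (simp add: base_lift_def base_point_in_base_plane base_translation_base_point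
        act_mult base_translation_in_SL2C)
  then have "A ** base_translation p = mat 1"
    using act_simply_transitive[OF e(1) e(1)] A e
    by (metis SL2C_mult SL2C_one act_one base_translation_in_SL2C)
  moreover have "A = A ** base_translation p ** translation (- Complex (p$1) (p$2))"
    by (simp add: base_translation_def matrix_mul_assoc[symmetric] translation_mult translation_0)
  ultimately have "A = translation (- Complex (p$1) (p$2))"
    by (metis matrix_mul_lid)
  then show "A \<in> range translation" by blast
next
  fix A assume "A \<in> range translation"
  then obtain b where A: "A = translation b" by blast
  have AS: "A \<in> SL2C" by (simp add: A translation_in_SL2C)
  have "HorS_act act A (base_element e) = base_element e"
    using e by (simp add: HorS_act_def base_element_def A mobius_translation_base_plane
        transport_base_lift act_in_E rotation_in_SL2C)
  then show "A \<in> {A \<in> SL2C. HorS_act act A (base_element e) = base_element e}"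
    using AS by simp
qed

text \<open>Move the spin frame \<open>e\<close> to an inward spin frame of \<open>h\<close>. Pulling
\<open>h\<close> back by the same element gives a spin-decorated horosphere with inward spin
frame \<open>e\<close> at the base point.\<close>

lemma HorS_transitive:
  assumes e: "e \<in> E" "pr e = base_frame 0" and h: "h \<in> HorS E pr"
  obtains A where "A \<in> SL2C" "h = HorS_act act A (base_element e)"
proof -
  obtain H Win Wout where h_eq: "h = (H, Win, Wout)" by (cases h)
  obtain \<xi> r v where r: "r > 0" and H: "H = horosphere \<xi> r"
    and Win: "continuous_lift E pr H (inward_frame \<xi> r v) Win"
    using h by (auto simp: HorS_def h_eq)
  \<comment> \<open>Any point of the horosphere will do; for a finite centre the highest one is explicit.\<close>
  obtain q where q: "q \<in> H"
  proof (cases \<xi>)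
    case (Finite_Point w)
    show thesis
      by (rule that[of "vector [Re w, Im w, 2 * r]"])
        (use r in \<open>auto simp: H Finite_Point sphere_3_iff U3_def simp del: mem_sphere\<close>)
  next
    case Infinite_Point
    show thesis by (rule that[of "vector [0, 0, r]"]) (simp add: H Infinite_Point)
  qed
  have HU: "H \<subseteq> U3" using horosphere_subset_U3[OF r] by (simp add: H)
  have Wq: "Win q \<in> E" "fst (pr (Win q)) = q"
    using Win q by (auto simp: continuous_lift_def inward_frame_def)
  obtain A where A: "A \<in> SL2C" "act A e = Win q"
    using act_simply_transitive[OF e(1) Wq(1)] by blast
  have Ai: "matrix_inv A \<in> SL2C" by (rule SL2C_inverse(3)[OF A(1)])
  have q_eq: "q = mobius A base_point"
    using Wq(2) pr_act[OF A(1) e(1)] by (simp add: A(2) e(2) frame_act_def base_frame_def)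
  define h' where "h' = HorS_act act (matrix_inv A) h"
  have h': "h' = (mobius (matrix_inv A) ` H, transport_field act (matrix_inv A) H Win,
      transport_field act (matrix_inv A) H Wout)"
    by (simp add: h'_def h_eq HorS_act_def)
  have base: "base_point = mobius (matrix_inv A) q"
    using mobius_inverse(1)[OF A(1) base_point_in_U3] by (simp add: q_eq)
  have "h' = base_element e"
    unfolding h'
  proof (rule base_element_unique[OF e])
    show "(mobius (matrix_inv A) ` H, transport_field act (matrix_inv A) H Win,
        transport_field act (matrix_inv A) H Wout) \<in> HorS E pr"
      using HorS_act_closed[OF Ai h] by (simp add: h'[symmetric] h'_def)
    show "base_point \<in> mobius (matrix_inv A) ` H"
      using q base by blast
    show "transport_field act (matrix_inv A) H Win base_point = e"
      using transport_field_apply[OF Ai HU q, of Win] act_inverse[OF A(1) e(1)] A(2)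
      by (simp add: base)
  qed
  moreover have "HorS_act act A h' = h"
    using HorS_act_mult[OF A(1) Ai h] HorS_act_one[OF h] SL2C_inverse(1)[OF A(1)]
    by (simp add: h'_def)
  ultimately show thesis using that A(1) by metis
qed

end

section \<open>Real coordinates on spinors\<close>

lemma vector_4_nth:
  "(vector [a, b, c, d] :: 'a::zero^4) $ 1 = a" "(vector [a, b, c, d] :: 'a^4) $ 2 = b"
  "(vector [a, b, c, d] :: 'a^4) $ 3 = c" "(vector [a, b, c, d] :: 'a^4) $ 4 = d"
  by (simp_all add: vector_def)

definition spinor_of_real4 :: "real^4 \<Rightarrow> complex^2" where
  "spinor_of_real4 x = vector [Complex (x$1) (x$2), Complex (x$3) (x$4)]"

definition real4_of_spinor :: "complex^2 \<Rightarrow> real^4" where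
  "real4_of_spinor \<kappa> = vector [Re (\<kappa>$1), Im (\<kappa>$1), Re (\<kappa>$2), Im (\<kappa>$2)]"

lemma spinor_of_real4_inverse [simp]: "real4_of_spinor (spinor_of_real4 x) = x"
  by (simp add: real4_of_spinor_def spinor_of_real4_def vec_eq_iff forall_4 vector_4_nth)

lemma real4_of_spinor_inverse [simp]: "spinor_of_real4 (real4_of_spinor \<kappa>) = \<kappa>"
  by (simp add: real4_of_spinor_def spinor_of_real4_def vec_eq_iff forall_2 vector_4_nth)

lemma bounded_linear_spinor_of_real4: "bounded_linear spinor_of_real4"
  unfolding linear_conv_bounded_linear[symmetric]
  by (rule linearI)
    (simp_all add: spinor_of_real4_def vec_eq_iff forall_2 complex_eq_iff)

lemma bounded_linear_real4_of_spinor: "bounded_linear real4_of_spinor"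
  unfolding linear_conv_bounded_linear[symmetric]
  by (rule linearI)
    (simp_all add: real4_of_spinor_def vec_eq_iff forall_4 vector_4_nth)

lemma spinor_of_real4_eq_0_iff: "spinor_of_real4 x = 0 \<longleftrightarrow> x = 0"
  by (metis spinor_of_real4_inverse bounded_linear_spinor_of_real4 bounded_linear.linear linear_0)

lemma real4_of_spinor_image: "real4_of_spinor ` nonzero_spinors = {x. x \<noteq> 0}"
proof (intro equalityI subsetI)
  fix x assume "x \<in> real4_of_spinor ` nonzero_spinors"
  then show "x \<in> {x. x \<noteq> 0}"
    by (metis (mono_tags, lifting) image_iff mem_Collect_eq nonzero_spinors_def
        real4_of_spinor_inverse spinor_of_real4_eq_0_iff)
next
  fix x :: "real^4" assume "x \<in> {x. x \<noteq> 0}"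
  then show "x \<in> real4_of_spinor ` nonzero_spinors"
    using spinor_of_real4_eq_0_iff[of x]
    by (intro image_eqI[of _ _ "spinor_of_real4 x"]) (auto simp: nonzero_spinors_def)
qed

lemma bounded_linear_column_pair:
  "bounded_linear (\<lambda>\<kappa>::complex^2. mat2 (\<kappa>$1) 0 (\<kappa>$2) 0)"
  "bounded_linear (\<lambda>\<kappa>::complex^2. mat2 0 (- cnj (\<kappa>$2)) 0 (cnj (\<kappa>$1)))"
  unfolding linear_conv_bounded_linear[symmetric]
  by (rule linearI; simp add: mat2_eq_iff scaleR_add_right)+

lemma smooth_on_spinor_matrix:
  "smooth_on {x. x \<noteq> 0} (\<lambda>x. spinor_matrix (spinor_of_real4 x))"
proof -
  have "Ck_on k {x. x \<noteq> 0} (\<lambda>x. spinor_matrix (spinor_of_real4 x))" for k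
    unfolding spinor_matrix_def
    by (intro Ck_on_add Ck_on_bilinear[OF bounded_bilinear_scaleR] Ck_on_inverse
        Ck_on_bilinear[OF bounded_bilinear_inner] Ck_on_bounded_linear open_nonzero
        bounded_linear_compose[OF bounded_linear_column_pair(1) bounded_linear_spinor_of_real4]
        bounded_linear_compose[OF bounded_linear_column_pair(2) bounded_linear_spinor_of_real4]
        bounded_linear_spinor_of_real4)
      (simp add: spinor_of_real4_eq_0_iff)
  then show ?thesis by (simp add: smooth_on_def open_nonzero)
qed

section \<open>The correspondence\<close>

context spin_frames
begin

definition spinor_horosphere :: "'e \<Rightarrow> complex^2 \<Rightarrow> 'e spin_horosphere" where
  "spinor_horosphere e \<kappa> = HorS_act act (spinor_matrix \<kappa>) (base_element e)"

context
  fixes e assumes e: "e \<in> E" "pr e = base_frame 0"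
begin

text \<open>The value on a spinor does not depend on the choice of the matrix with that first column, since
two choices differ by an element of the stabiliser.\<close>

lemma HorS_act_base_element:
  assumes "A \<in> SL2C"
  shows "HorS_act act A (base_element e) = spinor_horosphere e (column 1 A)"
proof -
  have S: "spinor_matrix (column 1 A) \<in> SL2C"
    by (rule spinor_matrix_in_SL2C[OF column_1_nonzero[OF assms]])
  obtain b where A: "A = spinor_matrix (column 1 A) ** translation b"
    using SL2C_same_first_column[OF assms S] by (metis column_spinor_matrix)
  have "HorS_act act (translation b) (base_element e) = base_element e"
    using stabiliser_base_element[OF e] by blast
  then have "HorS_act act (spinor_matrix (column 1 A) ** translation b) (base_element e)
      = spinor_horosphere e (column 1 A)"
    using HorS_act_mult[OF S translation_in_SL2C base_element_in_HorS[OF e]]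
    by (simp add: spinor_horosphere_def)
  then show ?thesis using A by metis
qed

lemma spinor_horosphere_equivariant:
  assumes "A \<in> SL2C" "\<kappa> \<in> nonzero_spinors"
  shows "spinor_horosphere e (A *v \<kappa>) = HorS_act act A (spinor_horosphere e \<kappa>)"
proof -
  have S: "spinor_matrix \<kappa> \<in> SL2C"
    using assms(2) by (simp add: nonzero_spinors_def spinor_matrix_in_SL2C)
  have "A *v \<kappa> = column 1 (A ** spinor_matrix \<kappa>)"
    by (simp add: column_mult column_spinor_matrix)
  then show ?thesis
    using HorS_act_base_element[OF SL2C_mult[OF assms(1) S]]
      HorS_act_mult[OF assms(1) S base_element_in_HorS[OF e]]
    by (simp add: spinor_horosphere_def)
qed

lemma bij_betw_spinor_horosphere: "bij_betw (spinor_horosphere e) nonzero_spinors (HorS E pr)"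
proof (intro bij_betwI')
  fix \<kappa> \<kappa>' assume \<kappa>: "\<kappa> \<in> nonzero_spinors" "\<kappa>' \<in> nonzero_spinors"
  let ?A = "spinor_matrix \<kappa>" and ?B = "spinor_matrix \<kappa>'"
  have S: "?A \<in> SL2C" "?B \<in> SL2C"
    using \<kappa> by (simp_all add: nonzero_spinors_def spinor_matrix_in_SL2C)
  note base = base_element_in_HorS[OF e]
  have "\<kappa> = \<kappa>'" if eq: "spinor_horosphere e \<kappa> = spinor_horosphere e \<kappa>'"
  proof -
    let ?C = "matrix_inv ?A ** ?B"
    have Ai: "matrix_inv ?A \<in> SL2C" by (rule SL2C_inverse(3)[OF S(1)])
    have "HorS_act act ?C (base_element e) = HorS_act act (matrix_inv ?A ** ?A) (base_element e)"
      using eq by (simp add: HorS_act_mult Ai S base spinor_horosphere_def)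
    then have "HorS_act act ?C (base_element e) = base_element e"
      by (simp add: SL2C_inverse(2)[OF S(1)] HorS_act_one base)
    then have "?C \<in> range translation"
      using stabiliser_base_element[OF e] SL2C_mult[OF Ai S(2)] by blast
    then obtain b where "?C = translation b" by blast
    moreover have "?B = ?A ** ?C"
      by (simp add: matrix_mul_assoc SL2C_inverse(1)[OF S(1)])
    ultimately show ?thesis
      by (metis column_translation column_spinor_matrix)
  qed
  then show "(spinor_horosphere e \<kappa> = spinor_horosphere e \<kappa>') = (\<kappa> = \<kappa>')" by blast
next
  fix \<kappa> assume "\<kappa> \<in> nonzero_spinors"
  then show "spinor_horosphere e \<kappa> \<in> HorS E pr"
    using HorS_act_closed[OF spinor_matrix_in_SL2C base_element_in_HorS[OF e]]
    by (simp add: spinor_horosphere_def nonzero_spinors_def)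
next
  fix h assume "h \<in> HorS E pr"
  then obtain A where A: "A \<in> SL2C" "h = HorS_act act A (base_element e)"
    using HorS_transitive[OF e] by blast
  then show "\<exists>\<kappa>\<in>nonzero_spinors. h = spinor_horosphere e \<kappa>"
    using HorS_act_base_element column_1_nonzero by (auto simp: nonzero_spinors_def)
qed

text \<open>The inverse of the correspondence, in real coordinates: a chart defined on all of \<open>HorS E
pr\<close>.\<close>

definition spinor_chart :: "'e spin_horosphere \<Rightarrow> real^4" where
  "spinor_chart h = real4_of_spinor (inv_into nonzero_spinors (spinor_horosphere e) h)"

lemma spinor_chart_spinor_horosphere:
  "\<kappa> \<in> nonzero_spinors \<Longrightarrow> spinor_chart (spinor_horosphere e \<kappa>) = real4_of_spinor \<kappa>"
  unfolding spinor_chart_def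
  by (simp add: inv_into_f_f[OF bij_betw_imp_inj_on[OF bij_betw_spinor_horosphere]])

lemma spinor_chart_image: "spinor_chart ` HorS E pr = {x. x \<noteq> 0}"
proof -
  have "spinor_chart ` HorS E pr = spinor_chart ` spinor_horosphere e ` nonzero_spinors"
    by (simp add: bij_betw_imp_surj_on[OF bij_betw_spinor_horosphere])
  also have "\<dots> = real4_of_spinor ` nonzero_spinors"
    by (auto simp: image_image spinor_chart_spinor_horosphere)
  finally show ?thesis by (simp add: real4_of_spinor_image)
qed

lemma inj_on_spinor_chart: "inj_on spinor_chart (HorS E pr)"
proof (rule inj_onI)
  fix h h' assume hs: "h \<in> HorS E pr" "h' \<in> HorS E pr" and eq: "spinor_chart h = spinor_chart h'"
  obtain \<kappa> \<kappa>' where \<kappa>: "\<kappa> \<in> nonzero_spinors" "\<kappa>' \<in> nonzero_spinors"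
    "h = spinor_horosphere e \<kappa>" "h' = spinor_horosphere e \<kappa>'"
    using hs bij_betw_imp_surj_on[OF bij_betw_spinor_horosphere] by blast
  then show "h = h'"
    using eq by (metis spinor_chart_spinor_horosphere real4_of_spinor_inverse)
qed

text \<open>In this chart the orbit map of the base element sends a matrix to its first column, a linear
map, and \<open>spinor_matrix\<close> is a smooth section of it.\<close>

lemma HorS_chart_spinor_chart: "HorS_chart E pr act (HorS E pr) spinor_chart"
proof -
  let ?q = "\<lambda>A. HorS_act act A (base_element e)"
  have dom: "{A \<in> SL2C. ?q A \<in> HorS E pr} = SL2C"
    using HorS_act_closed base_element_in_HorS[OF e] by blast
  have chart: "spinor_chart (?q A) = real4_of_spinor (column 1 A)" if "A \<in> SL2C" for A
    using that HorS_act_base_element column_1_nonzero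
    by (simp add: spinor_chart_spinor_horosphere nonzero_spinors_def)
  have "locally_extends_smoothly SL2C (\<lambda>A. spinor_chart (?q A))"
    by (rule locally_extends_smoothly_bounded_linear[OF
          bounded_linear_compose[OF bounded_linear_real4_of_spinor bounded_linear_column] chart])
  moreover have "spinor_matrix (spinor_of_real4 x) \<in> SL2C"
    "spinor_chart (?q (spinor_matrix (spinor_of_real4 x))) = x" if "x \<noteq> 0" for x
    using that chart[of "spinor_matrix (spinor_of_real4 x)"]
    by (simp_all add: spinor_matrix_in_SL2C spinor_of_real4_eq_0_iff column_spinor_matrix)
  ultimately have "quotient_chart ?q (HorS E pr) spinor_chart"
    unfolding quotient_chart_def dom spinor_chart_image
    using inj_on_spinor_chart open_nonzero smooth_on_spinor_matrix
      HorS_act_closed[OF _ base_element_in_HorS[OF e]]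
    by (auto intro!: exI[of _ "{x. x \<noteq> 0}"] exI[of _ "\<lambda>x. spinor_matrix (spinor_of_real4 x)"])
  then show ?thesis
    unfolding HorS_chart_def
    using base_element_in_HorS[OF e] stabiliser_base_element[OF e] parabolic_subgroup_P_eq by auto
qed

lemma smooth_into_HorS_spinor_horosphere:
  "smooth_into_HorS E pr act nonzero_spinors (spinor_horosphere e)"
proof -
  have "smooth_on nonzero_spinors (\<lambda>\<kappa>. spinor_chart (spinor_horosphere e \<kappa>))"
    by (rule smooth_on_cong[OF smooth_on_bounded_linear[OF _ bounded_linear_real4_of_spinor]])
      (simp_all add: nonzero_spinors_def open_nonzero spinor_chart_spinor_horosphere)
  then show ?thesis
    unfolding smooth_into_HorS_def
    using HorS_chart_spinor_chart bij_betw_imp_surj_on[OF bij_betw_spinor_horosphere] by blast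
qed

lemma smooth_from_HorS_spinor:
  "smooth_from_HorS E pr act (inv_into nonzero_spinors (spinor_horosphere e))"
proof -
  have "smooth_on {x. x \<noteq> 0}
      (\<lambda>y. inv_into nonzero_spinors (spinor_horosphere e) (inv_into (HorS E pr) spinor_chart y))"
  proof (rule smooth_on_cong[OF smooth_on_bounded_linear[OF open_nonzero bounded_linear_spinor_of_real4]])
    fix y :: "real^4" assume "y \<in> {x. x \<noteq> 0}"
    then have "y \<in> spinor_chart ` HorS E pr" by (simp add: spinor_chart_image)
    then have "spinor_chart (inv_into (HorS E pr) spinor_chart y) = y"
      by (rule f_inv_into_f)
    then show "inv_into nonzero_spinors (spinor_horosphere e) (inv_into (HorS E pr) spinor_chart y)
        = spinor_of_real4 y"
      by (metis spinor_chart_def real4_of_spinor_inverse)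
  qed
  then show ?thesis
    unfolding smooth_from_HorS_def using HorS_chart_spinor_chart spinor_chart_image by metis
qed

end

end

theorem theorem1:
  fixes E :: "'e::topological_space set"
    and pr :: "'e \<Rightarrow> frame"
    and act :: "complex^2^2 \<Rightarrow> 'e \<Rightarrow> 'e"
  assumes "spin_frame_bundle E pr act"
  shows "\<exists>f :: complex^2 \<Rightarrow> 'e spin_horosphere.
           bij_betw f nonzero_spinors (HorS E pr) \<and>
           (\<forall>A\<in>SL2C. \<forall>\<kappa>\<in>nonzero_spinors. f (A *v \<kappa>) = HorS_act act A (f \<kappa>)) \<and>
           smooth_into_HorS E pr act nonzero_spinors f \<and>
           smooth_from_HorS E pr act (inv_into nonzero_spinors f)"
proof -
  interpret spin_frames E pr act
    by standard (rule assms)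
  obtain e where e: "e \<in> E" "pr e = base_frame 0"
    using frame_lift_exists[OF base_frame_in_frames] by blast
  show ?thesis
    using bij_betw_spinor_horosphere[OF e] spinor_horosphere_equivariant[OF e]
      smooth_into_HorS_spinor_horosphere[OF e] smooth_from_HorS_spinor[OF e] by blast
qed

end
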